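(* Let $(M,g,J)$ be a compact Hermitian manifold. Suppose $(\nabla^{\mathrm{Ch},\mathbb R},g)$ is real Chern-Einstein with constant $\lambda\in\mathbb R$, i.e. $\mathrm{Ric}(\nabla^{\mathrm{Ch},\mathbb R},g)=\lambda g$. If $\lambda\neq 0$, then $(M,g,J)$ is Kähler-Einstein.
   Context: A Hermitian manifold $(M,g,J)$ is a smooth manifold $M$ of real dimension $2n$ with a Riemannian metric $g$ and an integrable complex structure $J\in\mathrm{End}(T_{\mathbb R}M)$ with $g(JX,JY)=g(X,Y)$; here $T_{\mathbb R}M$ is the real tangent bundle. The fundamental form is $\omega(X,Y)=g(JX,Y)$, and $\nabla^{\mathrm{LC}}$ is the Levi-Civita connection of $g$. The real Chern connection $\nabla^{\mathrm{Ch},\mathbb R}$ is the unique affine connection on $T_{\mathbb R}M$ preserving both $g$ and $J$ whose complexification restricts on $T^{1,0}M$ to the Chern connection (the unique connection on $T^{1,0}M$ compatible with the Hermitian metric and with the holomorphic structure $\bar\partial$). Equivalently, $g(\nabla^{\mathrm{Ch},\mathbb R}_XY,Z)=g(\nabla^{\mathrm{LC}}_XY,Z)-\frac12 d\omega(JX,Y,Z)$. Its curvature is $R^{\mathrm{Ch},\mathbb R}(X,Y,Z,W)=g(\nabla_X\nabla_YZ-\nabla_Y\nabla_XZ-\nabla_{[X,Y]}Z,W)$ with $\nabla=\nabla^{\mathrm{Ch},\mathbb R}$, and the real Chern-Ricci curvature is $\mathrm{Ric}(\nabla^{\mathrm{Ch},\mathbb R},g)(X,Y)=\sum_{i=1}^{2n}R^{\mathrm{Ch},\mathbb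 R}(X,e_i,e_i,Y)$, where $\{e_i\}_{i=1}^{2n}$ is a $g$-orthonormal frame. Kähler-Einstein means $d\omega=0$ and the Riemannian Ricci curvature of $g$ is a constant multiple of $g$. *)

theory Defs
  imports "HOL-Analysis.Analysis" "HOL-Library.Function_Algebras"
begin

section \<open>Smooth manifolds\<close>

text \<open>Here a manifold is a whole type \<open>'m\<close>, modelled on the Euclidean space \<open>'e\<close>;
  Hausdorffness and second countability come from the type classes. A chart \<open>(U, \<phi>)\<close> is used
  through the restriction of \<open>\<phi>\<close> to \<open>U\<close>, the value of \<open>\<phi>\<close> outside \<open>U\<close> is irrelevant.
  The atlas need not be maximal.\<close>

type_synonym ('m, 'e) chart = "'m set \<times> ('m \<Rightarrow> 'e)"
type_synonym ('m, 'e) atlas = "('m, 'e) chart set"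

primrec Ck_on ::
  "nat \<Rightarrow> 'a::real_normed_vector set \<Rightarrow> ('a \<Rightarrow> 'b::real_normed_vector) \<Rightarrow> bool" where
  "Ck_on 0 S f \<longleftrightarrow> continuous_on S f"
| "Ck_on (Suc k) S f \<longleftrightarrow> (\<forall>x\<in>S. f differentiable (at x)) \<and>
     (\<forall>v. Ck_on k S (\<lambda>x. frechet_derivative f (at x) v))"

text \<open>Only used for open \<open>S\<close>.\<close>
definition smooth_on ::
  "'a::real_normed_vector set \<Rightarrow> ('a \<Rightarrow> 'b::real_normed_vector) \<Rightarrow> bool" where
  "smooth_on S f \<longleftrightarrow> (\<forall>k. Ck_on k S f)"

definition is_chart :: "('m::topological_space, 'e::euclidean_space) chart \<Rightarrow> bool" where
  "is_chart c \<longleftrightarrow> (case c of (U, \<phi>) \<Rightarrow>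
     open U \<and> open (\<phi> ` U) \<and> homeomorphism U (\<phi> ` U) \<phi> (inv_into U \<phi>))"

definition smooth_atlas ::
  "('m::{t2_space, second_countable_topology}, 'e::euclidean_space) atlas \<Rightarrow> bool" where
  "smooth_atlas A \<longleftrightarrow> (\<forall>c\<in>A. is_chart c) \<and> (\<Union>c\<in>A. fst c) = UNIV \<and>
     (\<forall>(U, \<phi>)\<in>A. \<forall>(V, \<psi>)\<in>A. smooth_on (\<phi> ` (U \<inter> V)) (\<psi> \<circ> inv_into U \<phi>))"

definition smooth_functions :: "('m, 'e::euclidean_space) atlas \<Rightarrow> ('m \<Rightarrow> real) set" where
  "smooth_functions A = {f. \<forall>(U, \<phi>)\<in>A. smooth_on (\<phi> ` U) (f \<circ> inv_into U \<phi>)}"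


section \<open>Tangent spaces and vector fields\<close>

text \<open>Tangent vectors at \<open>p\<close> are the derivations at \<open>p\<close> of the algebra of smooth functions.
  To make them unique as HOL functions they are set to \<open>0\<close> on non-smooth functions. Addition,
  subtraction and zero of tangent vectors and of vector fields are the pointwise operations of
  \<^theory>\<open>HOL-Library.Function_Algebras\<close>.\<close>

type_synonym 'm tvec = "('m \<Rightarrow> real) \<Rightarrow> real"
type_synonym 'm vfield = "'m \<Rightarrow> 'm tvec"
type_synonym 'm connection = "'m vfield \<Rightarrow> 'm vfield \<Rightarrow> 'm vfield"

definition tscale :: "real \<Rightarrow> 'm tvec \<Rightarrow> 'm tvec" where
  "tscale c v = (\<lambda>f. c * v f)"

definition tangent_space :: "('m, 'e::euclidean_space) atlas \<Rightarrow> 'm \<Rightarrow> 'm tvec set" where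
  "tangent_space A p = {v.
     (\<forall>f\<in>smooth_functions A. \<forall>h\<in>smooth_functions A. v (\<lambda>q. f q + h q) = v f + v h) \<and>
     (\<forall>c. \<forall>f\<in>smooth_functions A. v (\<lambda>q. c * f q) = c * v f) \<and>
     (\<forall>f\<in>smooth_functions A. \<forall>h\<in>smooth_functions A.
        v (\<lambda>q. f q * h q) = v f * h p + f p * v h) \<and>
     (\<forall>f. f \<notin> smooth_functions A \<longrightarrow> v f = 0)}"

definition vfields :: "('m, 'e::euclidean_space) atlas \<Rightarrow> 'm vfield set" where
  "vfields A = {X. (\<forall>p. X p \<in> tangent_space A p) \<and>
     (\<forall>f\<in>smooth_functions A. (\<lambda>p. X p f) \<in> smooth_functions A)}"

definition fscale :: "('m \<Rightarrow> real) \<Rightarrow> 'm vfield \<Rightarrow> 'm vfield" where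
  "fscale f X = (\<lambda>p. tscale (f p) (X p))"

definition lie_bracket :: "'m vfield \<Rightarrow> 'm vfield \<Rightarrow> 'm vfield" where
  "lie_bracket X Y = (\<lambda>p f. X p (\<lambda>q. Y q f) - Y p (\<lambda>q. X q f))"


section \<open>Hermitian manifolds\<close>

type_synonym 'm metric = "'m \<Rightarrow> 'm tvec \<Rightarrow> 'm tvec \<Rightarrow> real"
type_synonym 'm endo = "'m \<Rightarrow> 'm tvec \<Rightarrow> 'm tvec"

definition met :: "'m metric \<Rightarrow> 'm vfield \<Rightarrow> 'm vfield \<Rightarrow> 'm \<Rightarrow> real" where
  "met g X Y = (\<lambda>p. g p (X p) (Y p))"

definition app :: "'m endo \<Rightarrow> 'm vfield \<Rightarrow> 'm vfield" where
  "app J X = (\<lambda>p. J p (X p))"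

definition riemannian_metric :: "('m, 'e::euclidean_space) atlas \<Rightarrow> 'm metric \<Rightarrow> bool" where
  "riemannian_metric A g \<longleftrightarrow>
     (\<forall>p. \<forall>u\<in>tangent_space A p. \<forall>v\<in>tangent_space A p.
        g p u v = g p v u \<and>
        (\<forall>w\<in>tangent_space A p. g p (u + v) w = g p u w + g p v w) \<and>
        (\<forall>c. g p (tscale c u) v = c * g p u v)) \<and>
     (\<forall>p. \<forall>u\<in>tangent_space A p. u \<noteq> 0 \<longrightarrow> g p u u > 0) \<and>
     (\<forall>X\<in>vfields A. \<forall>Y\<in>vfields A. met g X Y \<in> smooth_functions A)"

text \<open>A smooth endomorphism field squaring to \<open>-1\<close>; integrability is the vanishing of the
  Nijenhuis tensor, i.e.\ involutivity of \<open>T\<^sup>1\<^sup>,\<^sup>0M\<close>.\<close>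

definition nijenhuis :: "'m endo \<Rightarrow> 'm vfield \<Rightarrow> 'm vfield \<Rightarrow> 'm vfield" where
  "nijenhuis J X Y =
     lie_bracket (app J X) (app J Y) - app J (lie_bracket (app J X) Y)
     - app J (lie_bracket X (app J Y)) - lie_bracket X Y"

definition integrable_complex_structure ::
  "('m, 'e::euclidean_space) atlas \<Rightarrow> 'm endo \<Rightarrow> bool" where
  "integrable_complex_structure A J \<longleftrightarrow>
     (\<forall>p. \<forall>u\<in>tangent_space A p. J p u \<in> tangent_space A p \<and> J p (J p u) = - u \<and>
        (\<forall>v\<in>tangent_space A p. J p (u + v) = J p u + J p v) \<and>
        (\<forall>c. J p (tscale c u) = tscale c (J p u))) \<and>
     (\<forall>X\<in>vfields A. app J X \<in> vfields A) \<and>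
     (\<forall>X\<in>vfields A. \<forall>Y\<in>vfields A. nijenhuis J X Y = 0)"

definition hermitian_manifold ::
  "('m::{t2_space, second_countable_topology}, 'e::euclidean_space) atlas \<Rightarrow>
     'm metric \<Rightarrow> 'm endo \<Rightarrow> bool" where
  "hermitian_manifold A g J \<longleftrightarrow> even DIM('e) \<and> smooth_atlas A \<and>
     riemannian_metric A g \<and> integrable_complex_structure A J \<and>
     (\<forall>p. \<forall>u\<in>tangent_space A p. \<forall>v\<in>tangent_space A p. g p (J p u) (J p v) = g p u v)"

definition fundamental_form ::
  "'m metric \<Rightarrow> 'm endo \<Rightarrow> 'm vfield \<Rightarrow> 'm vfield \<Rightarrow> 'm \<Rightarrow> real" where
  "fundamental_form g J X Y = met g (app J X) Y"

text \<open>Exterior derivative of a 2-form, without the factor \<open>1/3\<close> used by some authors.\<close>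
definition ext_deriv2 ::
  "('m vfield \<Rightarrow> 'm vfield \<Rightarrow> 'm \<Rightarrow> real) \<Rightarrow>
     'm vfield \<Rightarrow> 'm vfield \<Rightarrow> 'm vfield \<Rightarrow> 'm \<Rightarrow> real" where
  "ext_deriv2 \<alpha> X Y Z = (\<lambda>p.
     X p (\<alpha> Y Z) - Y p (\<alpha> X Z) + Z p (\<alpha> X Y)
     - \<alpha> (lie_bracket X Y) Z p + \<alpha> (lie_bracket X Z) Y p - \<alpha> (lie_bracket Y Z) X p)"


section \<open>Affine connections\<close>

definition affine_connection :: "('m, 'e::euclidean_space) atlas \<Rightarrow> 'm connection \<Rightarrow> bool" where
  "affine_connection A D \<longleftrightarrow>
     (\<forall>X\<in>vfields A. \<forall>Y\<in>vfields A. D X Y \<in> vfields A) \<and>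
     (\<forall>X\<in>vfields A. \<forall>Y\<in>vfields A. \<forall>Z\<in>vfields A.
        D (X + Y) Z = D X Z + D Y Z \<and> D X (Y + Z) = D X Y + D X Z) \<and>
     (\<forall>f\<in>smooth_functions A. \<forall>X\<in>vfields A. \<forall>Y\<in>vfields A.
        D (fscale f X) Y = fscale f (D X Y) \<and>
        D X (fscale f Y) = fscale (\<lambda>p. X p f) Y + fscale f (D X Y))"

definition preserves_metric ::
  "('m, 'e::euclidean_space) atlas \<Rightarrow> 'm metric \<Rightarrow> 'm connection \<Rightarrow> bool" where
  "preserves_metric A g D \<longleftrightarrow> (\<forall>X\<in>vfields A. \<forall>Y\<in>vfields A. \<forall>Z\<in>vfields A. \<forall>p.
     X p (met g Y Z) = met g (D X Y) Z p + met g Y (D X Z) p)"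

definition preserves_endo ::
  "('m, 'e::euclidean_space) atlas \<Rightarrow> 'm endo \<Rightarrow> 'm connection \<Rightarrow> bool" where
  "preserves_endo A J D \<longleftrightarrow>
     (\<forall>X\<in>vfields A. \<forall>Y\<in>vfields A. D X (app J Y) = app J (D X Y))"

definition levi_civita_connection ::
  "('m, 'e::euclidean_space) atlas \<Rightarrow> 'm metric \<Rightarrow> 'm connection \<Rightarrow> bool" where
  "levi_civita_connection A g D \<longleftrightarrow> affine_connection A D \<and> preserves_metric A g D \<and>
     (\<forall>X\<in>vfields A. \<forall>Y\<in>vfields A. D X Y - D Y X = lie_bracket X Y)"

definition curvature ::
  "'m metric \<Rightarrow> 'm connection \<Rightarrow>
     'm vfield \<Rightarrow> 'm vfield \<Rightarrow> 'm vfield \<Rightarrow> 'm vfield \<Rightarrow> 'm \<Rightarrow> real" where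
  "curvature g D X Y Z W =
     met g (D X (D Y Z) - D Y (D X Z) - D (lie_bracket X Y) Z) W"

text \<open>Vector fields that are orthonormal at \<open>p\<close>. The curvature is a tensor, so its trace
  at \<open>p\<close> depends neither on the orthonormal basis \<open>E i p\<close> (\<open>i < DIM('e)\<close>) of the tangent space
  nor on its extension to vector fields.\<close>
definition orthonormal_frame_at ::
  "('m, 'e::euclidean_space) atlas \<Rightarrow> 'm metric \<Rightarrow> 'm \<Rightarrow> (nat \<Rightarrow> 'm vfield) \<Rightarrow> bool" where
  "orthonormal_frame_at A g p E \<longleftrightarrow> (\<forall>i<DIM('e). E i \<in> vfields A) \<and>
     (\<forall>i<DIM('e). \<forall>j<DIM('e). met g (E i) (E j) p = (if i = j then 1 else 0))"

definition ricci ::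
  "('m, 'e::euclidean_space) atlas \<Rightarrow> 'm metric \<Rightarrow> 'm connection \<Rightarrow>
     'm vfield \<Rightarrow> 'm vfield \<Rightarrow> 'm \<Rightarrow> real" where
  "ricci A g D X Y p = (let E = (SOME E. orthonormal_frame_at A g p E)
     in \<Sum>i<DIM('e). curvature g D X (E i) (E i) Y p)"

definition einstein ::
  "('m, 'e::euclidean_space) atlas \<Rightarrow> 'm metric \<Rightarrow> 'm connection \<Rightarrow> real \<Rightarrow> bool" where
  "einstein A g D c \<longleftrightarrow>
     (\<forall>X\<in>vfields A. \<forall>Y\<in>vfields A. \<forall>p. ricci A g D X Y p = c * met g X Y p)"

text \<open>The Levi-Civita connection is unique on \<open>vfields A\<close>; the \<open>\<exists>D\<close> only names it.\<close>
definition kaehler_einstein ::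
  "('m, 'e::euclidean_space) atlas \<Rightarrow> 'm metric \<Rightarrow> 'm endo \<Rightarrow> bool" where
  "kaehler_einstein A g J \<longleftrightarrow>
     (\<forall>X\<in>vfields A. \<forall>Y\<in>vfields A. \<forall>Z\<in>vfields A.
        ext_deriv2 (fundamental_form g J) X Y Z = 0) \<and>
     (\<exists>D. levi_civita_connection A g D \<and> (\<exists>c. einstein A g D c))"


section \<open>The complexified tangent bundle and the Chern connection\<close>

text \<open>A complex vector field \<open>X + \<i> Y\<close> is the complex-valued derivation
  \<open>f \<mapsto> X f + \<i> (Y f)\<close> of real functions.\<close>

type_synonym 'm cvfield = "'m \<Rightarrow> ('m \<Rightarrow> real) \<Rightarrow> complex"

definition cvf :: "'m vfield \<Rightarrow> 'm vfield \<Rightarrow> 'm cvfield" where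
  "cvf X Y = (\<lambda>p f. Complex (X p f) (Y p f))"

definition re_vf :: "'m cvfield \<Rightarrow> 'm vfield" where
  "re_vf V = (\<lambda>p f. Re (V p f))"

definition im_vf :: "'m cvfield \<Rightarrow> 'm vfield" where
  "im_vf V = (\<lambda>p f. Im (V p f))"

definition cnj_vf :: "'m cvfield \<Rightarrow> 'm cvfield" where
  "cnj_vf V = (\<lambda>p f. cnj (V p f))"

definition csmooth_functions :: "('m, 'e::euclidean_space) atlas \<Rightarrow> ('m \<Rightarrow> complex) set" where
  "csmooth_functions A =
     {F. (\<lambda>p. Re (F p)) \<in> smooth_functions A \<and> (\<lambda>p. Im (F p)) \<in> smooth_functions A}"

definition cvfields :: "('m, 'e::euclidean_space) atlas \<Rightarrow> 'm cvfield set" where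
  "cvfields A = {V. re_vf V \<in> vfields A \<and> im_vf V \<in> vfields A}"

definition cscale :: "('m \<Rightarrow> complex) \<Rightarrow> 'm cvfield \<Rightarrow> 'm cvfield" where
  "cscale F V = (\<lambda>p f. F p * V p f)"

text \<open>Derivative of a complex function along a complex vector field.\<close>
definition cdir :: "'m cvfield \<Rightarrow> ('m \<Rightarrow> complex) \<Rightarrow> 'm \<Rightarrow> complex" where
  "cdir V F p = V p (\<lambda>q. Re (F q)) + \<i> * V p (\<lambda>q. Im (F q))"

text \<open>Complex bilinear extension of a real bilinear operation such as the Lie bracket or a
  connection, and complex linear extension of an endomorphism.\<close>
definition complexify ::
  "('m vfield \<Rightarrow> 'm vfield \<Rightarrow> 'm vfield) \<Rightarrow> 'm cvfield \<Rightarrow> 'm cvfield \<Rightarrow> 'm cvfield" where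
  "complexify B V W =
     cvf (B (re_vf V) (re_vf W) - B (im_vf V) (im_vf W))
         (B (re_vf V) (im_vf W) + B (im_vf V) (re_vf W))"

definition capp :: "'m endo \<Rightarrow> 'm cvfield \<Rightarrow> 'm cvfield" where
  "capp J V = cvf (app J (re_vf V)) (app J (im_vf V))"

definition T10 :: "('m, 'e::euclidean_space) atlas \<Rightarrow> 'm endo \<Rightarrow> 'm cvfield set" where
  "T10 A J = {V \<in> cvfields A. capp J V = cscale (\<lambda>_. \<i>) V}"

definition T01 :: "('m, 'e::euclidean_space) atlas \<Rightarrow> 'm endo \<Rightarrow> 'm cvfield set" where
  "T01 A J = {V \<in> cvfields A. capp J V = cscale (\<lambda>_. - \<i>) V}"

definition proj10 :: "'m endo \<Rightarrow> 'm cvfield \<Rightarrow> 'm cvfield" where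
  "proj10 J V = cscale (\<lambda>_. 1 / 2) (V - cscale (\<lambda>_. \<i>) (capp J V))"

text \<open>The holomorphic structure of \<open>T\<^sup>1\<^sup>,\<^sup>0M\<close>:
  the operator \<open>\<partial>\<close>-bar on a section \<open>W\<close>, evaluated on \<open>V\<close> of type \<open>(0,1)\<close>.\<close>
definition dbar :: "'m endo \<Rightarrow> 'm cvfield \<Rightarrow> 'm cvfield \<Rightarrow> 'm cvfield" where
  "dbar J V W = proj10 J (complexify lie_bracket V W)"

text \<open>The Hermitian metric \<open>h(V, W) = g(V, W\<close>-bar\<open>)\<close>, with \<open>g\<close> extended
  complex bilinearly.\<close>
definition hmet :: "'m metric \<Rightarrow> 'm cvfield \<Rightarrow> 'm cvfield \<Rightarrow> 'm \<Rightarrow> complex" where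
  "hmet g V W p = Complex
     (met g (re_vf V) (re_vf W) p + met g (im_vf V) (im_vf W) p)
     (met g (im_vf V) (re_vf W) p - met g (re_vf V) (im_vf W) p)"

text \<open>\<open>K U V\<close> is the derivative of the section \<open>V\<close> of \<open>T\<^sup>1\<^sup>,\<^sup>0M\<close>
  along the complex vector field \<open>U\<close>.\<close>
definition chern_connection_T10 ::
  "('m, 'e::euclidean_space) atlas \<Rightarrow> 'm metric \<Rightarrow> 'm endo \<Rightarrow>
     ('m cvfield \<Rightarrow> 'm cvfield \<Rightarrow> 'm cvfield) \<Rightarrow> bool" where
  "chern_connection_T10 A g J K \<longleftrightarrow>
     (\<forall>U\<in>cvfields A. \<forall>V\<in>T10 A J. K U V \<in> T10 A J) \<and>
     (\<forall>U\<in>cvfields A. \<forall>U'\<in>cvfields A. \<forall>V\<in>T10 A J. K (U + U') V = K U V + K U' V) \<and>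
     (\<forall>U\<in>cvfields A. \<forall>V\<in>T10 A J. \<forall>W\<in>T10 A J. K U (V + W) = K U V + K U W) \<and>
     (\<forall>F\<in>csmooth_functions A. \<forall>U\<in>cvfields A. \<forall>V\<in>T10 A J.
        K (cscale F U) V = cscale F (K U V) \<and>
        K U (cscale F V) = cscale (cdir U F) V + cscale F (K U V)) \<and>
     (\<forall>U\<in>cvfields A. \<forall>V\<in>T10 A J. \<forall>W\<in>T10 A J. \<forall>p.
        cdir U (hmet g V W) p = hmet g (K U V) W p + hmet g V (K (cnj_vf U) W) p) \<and>
     (\<forall>V\<in>T01 A J. \<forall>W\<in>T10 A J. K V W = dbar J V W)"

definition real_chern_connection ::
  "('m, 'e::euclidean_space) atlas \<Rightarrow> 'm metric \<Rightarrow> 'm endo \<Rightarrow> 'm connection \<Rightarrow> bool" where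
  "real_chern_connection A g J D \<longleftrightarrow> affine_connection A D \<and>
     preserves_metric A g D \<and> preserves_endo A J D \<and>
     chern_connection_T10 A g J (complexify D)"

end

theory Submission
  imports Defs
begin

text \<open>Let \<open>T\<close> be the torsion and \<open>R\<close> the curvature of the real Chern connection \<open>\<nabla>\<close>. The condition on the
  \<open>(0,1)\<close>-part gives \<open>T(JX, Y) = J T(X, Y)\<close>, and then the first Bianchi identity together with
  metric compatibility gives \<open>R(JX, JY) = R(X, Y)\<close>. Take the second Bianchi identity
  \<open>\<Sum> (\<nabla>\<^sub>X R)(Y, E) + R(T(X, Y), E) = 0\<close> (cyclic in \<open>X, Y, E\<close>), subtract its instance at
  \<open>JX, JY, E\<close>, apply it to \<open>E\<close> and sum over an orthonormal frame of vectors \<open>E\<close>. All terms not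
  involving the Ricci curvature cancel, those involving its derivative vanish because
  \<open>\<nabla>Ric = \<lambda> \<nabla>g = 0\<close>, and what remains is \<open>2 \<lambda> g(T(X, Y), W) = 0\<close>. Hence \<open>T = 0\<close>: the
  connection is the Levi-Civita connection, and \<open>d\<omega> = 0\<close>. No integration is involved.

  To differentiate the Ricci trace one needs frames near a point. Global vector fields \<open>F\<^sub>i\<close> that are
  orthogonal everywhere and orthonormal at the point come from a denominator-free Gram-Schmidt
  process; cutoff functions and Hadamard's lemma show that tangent spaces, defined through
  derivations, have the expected dimension.\<close>

subsection \<open>Smooth functions on open sets\<close>

text \<open>Tracing the second Bianchi identity over E alone is not enough: the terms
  \<open>(\<nabla>\<^sub>E R)(X, Y)\<close> and \<open>R(T(Y, E), X)\<close> are not controlled by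
  the Ricci trace. They are unchanged when X, Y become JX, JY: for the first this is the invariance
  of R together with \<open>\<nabla>J = 0\<close>, for the second T(JY, E) = J T(Y, E), and R
  absorbs the two factors J. The term R(T(X, Y), E) instead changes sign, because T(JX, JY) = J^2
  T(X, Y) = - T(X, Y). So the difference removes everything uncontrolled and doubles the term that
  is wanted.

  The analytic part is shaped by the encoding: vector fields are global, and tangent vectors are
  derivations of global functions. Local frames and quotients by squared norms are not objects here,
  so each local identity is multiplied by functions that equal 1 at the point until it becomes an
  identity between global smooth functions, to which a derivation can be applied.\<close>

lemma Ck_on_SucD: "Ck_on (Suc k) S f \<Longrightarrow> Ck_on k S f"
proof (induction k arbitrary: f)
  case 0
  then show ?case
    by (auto intro!: continuous_at_imp_continuous_on differentiable_imp_continuous_within)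
next
  case (Suc k)
  have "f differentiable (at x)" if "x \<in> S" for x
    using Suc.prems that by simp
  moreover have "Ck_on k S (\<lambda>x. frechet_derivative f (at x) v)" for v
    by (rule Suc.IH) (use Ck_on.simps(2)[THEN iffD1, OF Suc.prems] in blast)
  ultimately show ?case
    by (metis Ck_on.simps(2))
qed

lemma Ck_on_cong_open:
  assumes "open S" "\<And>x. x \<in> S \<Longrightarrow> f x = g x" "Ck_on k S f"
  shows "Ck_on k S g"
  using assms(2,3)
proof (induction k arbitrary: f g)
  case 0
  then show ?case by (simp cong: continuous_on_cong)
next
  case (Suc k)
  have d: "(g has_derivative frechet_derivative f (at x)) (at x)" if "x \<in> S" for x
  proof (rule has_derivative_transform_within_open[OF _ assms(1) that])
    show "(f has_derivative frechet_derivative f (at x)) (at x)"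
      using Suc.prems(2) that by (simp add: frechet_derivative_works)
  qed (use Suc.prems(1) in auto)
  then have "frechet_derivative f (at x) v = frechet_derivative g (at x) v" if "x \<in> S" for x v
    using that by (metis frechet_derivative_at)
  moreover have "Ck_on k S (\<lambda>x. frechet_derivative f (at x) v)" for v
    using Suc.prems(2) by simp
  ultimately have "Ck_on k S (\<lambda>x. frechet_derivative g (at x) v)" for v
    by (rule Suc.IH)
  moreover have "g differentiable (at x)" if "x \<in> S" for x
    using d[OF that] by (rule differentiableI)
  ultimately show ?case
    by simp
qed

text \<open>Uniqueness of derivatives lets an explicitly computed derivative replace
  \<open>frechet_derivative\<close>; the closure rules below then become inductions on the order of
  smoothness.\<close>

lemma Ck_on_SucI:
  assumes "open S" "\<And>x. x \<in> S \<Longrightarrow> (f has_derivative F x) (at x)" "\<And>v. Ck_on k S (\<lambda>x. F x v)"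
  shows "Ck_on (Suc k) S f"
proof -
  have "Ck_on k S (\<lambda>x. frechet_derivative f (at x) v)" for v
    by (rule Ck_on_cong_open[OF assms(1) _ assms(3)[of v]])
       (use frechet_derivative_at[OF assms(2)] in auto)
  moreover have "f differentiable (at x)" if "x \<in> S" for x
    using assms(2)[OF that] by (rule differentiableI)
  ultimately show ?thesis
    by simp
qed

lemma Ck_on_SucE:
  assumes "Ck_on (Suc k) S f" "x \<in> S"
  shows "(f has_derivative frechet_derivative f (at x)) (at x)"
  using assms by (simp add: frechet_derivative_works)

lemma Ck_on_subset: "Ck_on k S f \<Longrightarrow> T \<subseteq> S \<Longrightarrow> Ck_on k T f"
proof (induction k arbitrary: f)
  case (Suc k)
  then have "Ck_on k T (\<lambda>x. frechet_derivative f (at x) v)" for v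
    by simp
  then show ?case
    using Suc.prems by auto
qed (simp add: continuous_on_subset)

lemma Ck_on_local:
  assumes "\<And>x. x \<in> S \<Longrightarrow> \<exists>T. open T \<and> x \<in> T \<and> Ck_on k T f"
  shows "Ck_on k S f"
  using assms
proof (induction k arbitrary: f)
  case 0
  show ?case unfolding Ck_on.simps
  proof (rule continuous_at_imp_continuous_on, rule ballI)
    fix x assume "x \<in> S"
    from 0[OF this] obtain T where "open T" "x \<in> T" "continuous_on T f"
      by auto
    then show "isCont f x"
      using continuous_on_eq_continuous_at by blast
  qed
next
  case (Suc k)
  have "f differentiable (at x)" if "x \<in> S" for x
    using Suc.prems[OF that] by auto
  moreover have "Ck_on k S (\<lambda>x. frechet_derivative f (at x) v)" for v
  proof (rule Suc.IH)
    fix x assume "x \<in> S"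
    from Suc.prems[OF this] obtain T where "open T" "x \<in> T" "Ck_on (Suc k) T f"
      by blast
    then show "\<exists>T. open T \<and> x \<in> T \<and> Ck_on k T (\<lambda>x. frechet_derivative f (at x) v)"
      by (intro exI[of _ T]) simp
  qed
  ultimately show ?case
    by simp
qed

lemma Ck_on_const: "Ck_on k S (\<lambda>x. c)"
  by (induction k arbitrary: c) simp_all

lemma Ck_on_bounded_linear: "bounded_linear f \<Longrightarrow> Ck_on k S f"
proof (induction k)
  case 0
  then show ?case by (simp add: linear_continuous_on)
next
  case (Suc k)
  have "frechet_derivative f (at x) = f" for x
    by (rule frechet_derivative_at[OF bounded_linear_imp_has_derivative[OF Suc.prems], symmetric])
  then show ?case
    using Suc.prems by (simp add: Ck_on_const bounded_linear_imp_differentiable)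
qed

lemma Ck_on_add:
  assumes "open S"
  shows "Ck_on k S f \<Longrightarrow> Ck_on k S g \<Longrightarrow> Ck_on k S (\<lambda>x. f x + g x)"
proof (induction k arbitrary: f g)
  case 0
  then show ?case by (simp add: continuous_on_add)
next
  case (Suc k)
  show ?case
  proof (rule Ck_on_SucI[OF assms])
    show "((\<lambda>x. f x + g x) has_derivative
      (\<lambda>v. frechet_derivative f (at x) v + frechet_derivative g (at x) v)) (at x)" if "x \<in> S" for x
      using Ck_on_SucE[OF Suc.prems(1) that] Ck_on_SucE[OF Suc.prems(2) that]
      by (rule has_derivative_add)
  qed (use Suc in auto)
qed

lemma Ck_on_mult:
  fixes f g :: "'a::real_normed_vector \<Rightarrow> real"
  assumes "open S"
  shows "Ck_on k S f \<Longrightarrow> Ck_on k S g \<Longrightarrow> Ck_on k S (\<lambda>x. f x * g x)"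
proof (induction k arbitrary: f g)
  case 0
  then show ?case by (simp add: continuous_on_mult)
next
  case (Suc k)
  show ?case
  proof (rule Ck_on_SucI[OF assms])
    show "((\<lambda>x. f x * g x) has_derivative
      (\<lambda>v. f x * frechet_derivative g (at x) v + frechet_derivative f (at x) v * g x)) (at x)"
      if "x \<in> S" for x
      using Ck_on_SucE[OF Suc.prems(1) that] Ck_on_SucE[OF Suc.prems(2) that]
      by (rule has_derivative_mult)
    show "Ck_on k S (\<lambda>x. f x * frechet_derivative g (at x) v + frechet_derivative f (at x) v * g x)" for v
      using Suc.prems Suc.prems[THEN Ck_on_SucD] by (intro Ck_on_add[OF assms] Suc.IH) simp_all
  qed
qed

lemma Ck_on_sum:
  assumes "open S"
  shows "(\<And>i. i \<in> I \<Longrightarrow> Ck_on k S (f i)) \<Longrightarrow> Ck_on k S (\<lambda>x. \<Sum>i\<in>I. f i x)"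
  by (induction I rule: infinite_finite_induct) (auto simp: Ck_on_const Ck_on_add[OF assms])

lemma Ck_on_compose_linear:
  assumes "open S" "bounded_linear L"
  shows "Ck_on k S f \<Longrightarrow> Ck_on k S (\<lambda>x. L (f x))"
proof (induction k arbitrary: f)
  case 0
  then show ?case
    using assms(2) by (simp add: bounded_linear.continuous_on)
next
  case (Suc k)
  show ?case
  proof (rule Ck_on_SucI[OF assms(1)])
    show "((\<lambda>x. L (f x)) has_derivative (\<lambda>v. L (frechet_derivative f (at x) v))) (at x)"
      if "x \<in> S" for x
      using Ck_on_SucE[OF Suc.prems that] assms(2) by (rule bounded_linear.has_derivative[rotated])
  qed (use Suc in auto)
qed

text \<open>In a basis, the chain rule gives products of a component of the derivative of
  \<open>G\<close> with a partial derivative of \<open>f\<close> composed with \<open>G\<close>. The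
  latter has the original shape, so the induction varies \<open>f\<close> and keeps \<open>G\<close>
  fixed.\<close>

lemma Ck_on_compose:
  fixes f :: "'b::euclidean_space \<Rightarrow> real" and G :: "'a::real_normed_vector \<Rightarrow> 'b"
  assumes "open S" "G ` S \<subseteq> T"
  shows "Ck_on k T f \<Longrightarrow> Ck_on k S G \<Longrightarrow> Ck_on k S (\<lambda>x. f (G x))"
proof (induction k arbitrary: f)
  case 0
  then show ?case
    using assms(2) by (simp add: continuous_on_compose2)
next
  case (Suc k)
  have inT: "G x \<in> T" if "x \<in> S" for x
    using assms(2) that by auto
  show ?case
  proof (rule Ck_on_SucI[OF assms(1)])
    fix x assume x: "x \<in> S"
    let ?f' = "frechet_derivative f (at (G x))"
    have f': "(f has_derivative ?f') (at (G x))"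
      using Ck_on_SucE[OF Suc.prems(1) inT[OF x]] .
    have d: "((\<lambda>x. f (G x)) has_derivative (\<lambda>v. ?f' (frechet_derivative G (at x) v))) (at x)"
      using Ck_on_SucE[OF Suc.prems(2) x] f' by (rule has_derivative_compose)
    have eq: "?f' (frechet_derivative G (at x) v) =
        (\<Sum>b\<in>Basis. (frechet_derivative G (at x) v \<bullet> b) * ?f' b)" for v
      using Linear_Algebra.linear_componentwise[OF has_derivative_linear[OF f'], of "frechet_derivative G (at x) v" 1]
      by simp
    have "(\<lambda>v. ?f' (frechet_derivative G (at x) v)) =
        (\<lambda>v. \<Sum>b\<in>Basis. (frechet_derivative G (at x) v \<bullet> b) * ?f' b)"
      using eq by (rule ext)
    with d show "((\<lambda>x. f (G x)) has_derivative
      (\<lambda>v. \<Sum>b\<in>Basis. (frechet_derivative G (at x) v \<bullet> b) * ?f' b)) (at x)"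
      by (simp only:)
  next
    fix v
    show "Ck_on k S (\<lambda>x. \<Sum>b\<in>Basis. (frechet_derivative G (at x) v \<bullet> b) *
        frechet_derivative f (at (G x)) b)"
    proof (intro Ck_on_sum Ck_on_mult assms(1))
      fix b :: 'b
      show "Ck_on k S (\<lambda>x. frechet_derivative G (at x) v \<bullet> b)"
        by (rule Ck_on_compose_linear[OF assms(1) bounded_linear_inner_left]) (use Suc.prems(2) in simp)
      show "Ck_on k S (\<lambda>x. frechet_derivative f (at (G x)) b)"
        using Ck_on_SucD[OF Suc.prems(2)] by (rule Suc.IH[rotated]) (use Suc.prems(1) in simp)
    qed
  qed
qed

lemma smooth_onD: "smooth_on S f \<Longrightarrow> Ck_on k S f"
  by (simp add: smooth_on_def)

lemma smooth_on_const: "smooth_on S (\<lambda>x. c)"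
  by (simp add: smooth_on_def Ck_on_const)

lemma smooth_on_bounded_linear: "bounded_linear f \<Longrightarrow> smooth_on S f"
  by (simp add: smooth_on_def Ck_on_bounded_linear)

lemma smooth_on_add: "open S \<Longrightarrow> smooth_on S f \<Longrightarrow> smooth_on S g \<Longrightarrow> smooth_on S (\<lambda>x. f x + g x)"
  by (simp add: smooth_on_def Ck_on_add)

lemma smooth_on_mult:
  fixes f g :: "'a::real_normed_vector \<Rightarrow> real"
  shows "open S \<Longrightarrow> smooth_on S f \<Longrightarrow> smooth_on S g \<Longrightarrow> smooth_on S (\<lambda>x. f x * g x)"
  by (simp add: smooth_on_def Ck_on_mult)

lemma smooth_on_diff:
  fixes f g :: "'a::real_normed_vector \<Rightarrow> real"
  assumes "open S" "smooth_on S f" "smooth_on S g"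
  shows "smooth_on S (\<lambda>x. f x - g x)"
  using smooth_on_add[OF assms(1,2) smooth_on_mult[OF assms(1) smooth_on_const[of S "-1"] assms(3)]]
  by simp

lemma smooth_on_sum:
  "open S \<Longrightarrow> (\<And>i. i \<in> I \<Longrightarrow> smooth_on S (f i)) \<Longrightarrow> smooth_on S (\<lambda>x. \<Sum>i\<in>I. f i x)"
  by (simp add: smooth_on_def Ck_on_sum)

lemma smooth_on_compose:
  fixes f :: "'b::euclidean_space \<Rightarrow> real" and G :: "'a::real_normed_vector \<Rightarrow> 'b"
  shows "open S \<Longrightarrow> G ` S \<subseteq> T \<Longrightarrow> smooth_on T f \<Longrightarrow> smooth_on S G \<Longrightarrow> smooth_on S (\<lambda>x. f (G x))"
  unfolding smooth_on_def using Ck_on_compose[of S G T] by blast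

lemma smooth_on_subset: "smooth_on S f \<Longrightarrow> T \<subseteq> S \<Longrightarrow> smooth_on T f"
  unfolding smooth_on_def using Ck_on_subset by blast

lemma smooth_on_cong_open:
  "open S \<Longrightarrow> (\<And>x. x \<in> S \<Longrightarrow> f x = g x) \<Longrightarrow> smooth_on S f \<Longrightarrow> smooth_on S g"
  unfolding smooth_on_def using Ck_on_cong_open[of S f g] by blast

lemma smooth_on_local:
  assumes "\<And>x. x \<in> S \<Longrightarrow> \<exists>T. open T \<and> x \<in> T \<and> smooth_on T f"
  shows "smooth_on S f"
  unfolding smooth_on_def
proof
  fix k
  show "Ck_on k S f"
  proof (rule Ck_on_local)
    fix x assume "x \<in> S"
    from assms[OF this] obtain T where "open T" "x \<in> T" "smooth_on T f" by blast
    then show "\<exists>T. open T \<and> x \<in> T \<and> Ck_on k T f"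
      by (intro exI[of _ T]) (simp add: smooth_onD)
  qed
qed

lemma smooth_on_imp_continuous_on: "smooth_on S f \<Longrightarrow> continuous_on S f"
  using smooth_onD[of S f 0] by simp

lemma smooth_on_has_derivative:
  "smooth_on S f \<Longrightarrow> x \<in> S \<Longrightarrow> (f has_derivative frechet_derivative f (at x)) (at x)"
  by (rule Ck_on_SucE[OF smooth_onD])

lemma smooth_on_frechet_derivative:
  "smooth_on S f \<Longrightarrow> smooth_on S (\<lambda>x. frechet_derivative f (at x) v)"
  unfolding smooth_on_def
proof
  fix k assume "\<forall>k. Ck_on k S f"
  then have "Ck_on (Suc k) S f" ..
  then show "Ck_on k S (\<lambda>x. frechet_derivative f (at x) v)" by simp
qed

subsection \<open>Bump functions\<close>

text \<open>The derivatives of \<open>exp (- 1 / t)\<close> are linear combinations of this family.\<close>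

definition flat :: "nat \<Rightarrow> real \<Rightarrow> real" where
  "flat k t = (if t \<le> 0 then 0 else exp (- 1 / t) / t ^ k)"

text \<open>From the right, \<open>s = 1 / t\<close> turns this into the limit of
  \<open>s^k / exp s\<close> at infinity.\<close>

lemma flat_tendsto_0: "(flat k \<longlongrightarrow> 0) (at 0)"
proof -
  have "((\<lambda>t. inverse t ^ k / exp (inverse t)) \<longlongrightarrow> (0::real)) (at_right 0)"
    by (rule filterlim_compose[OF tendsto_power_div_exp_0 filterlim_inverse_at_top_right])
  moreover have "eventually (\<lambda>t. inverse t ^ k / exp (inverse t) = flat k t) (at_right 0)"
    by (rule eventually_at_rightI[of 0 1])
       (simp_all add: flat_def exp_minus divide_simps)
  ultimately have "(flat k \<longlongrightarrow> 0) (at_right 0)"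
    by (rule Lim_transform_eventually)
  moreover have "(flat k \<longlongrightarrow> 0) (at_left 0)"
    by (rule tendsto_eventually, rule eventually_at_leftI[of "-1"]) (simp_all add: flat_def)
  ultimately show ?thesis
    by (simp add: filterlim_split_at)
qed

lemma flat_has_derivative:
  "(flat k has_real_derivative flat (k + 2) t - real k * flat (k + 1) t) (at t)"
proof (cases t "0::real" rule: linorder_cases)
  case less
  have "((\<lambda>_. 0) has_real_derivative 0) (at t)" by simp
  then have "(flat k has_real_derivative 0) (at t)"
    by (rule has_field_derivative_transform_within_open[of _ _ _ "{..<0}"])
       (use less in \<open>auto simp: flat_def\<close>)
  then show ?thesis
    using less by (simp add: flat_def)
next
  case equal
  \<comment> \<open>The difference quotient of \<open>flat k\<close> at 0 is
    \<open>flat (k + 1)\<close> itself.\<close>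
  have "((\<lambda>h. (flat k h - flat k 0) / (h - 0)) \<longlongrightarrow> 0) (at 0)"
  proof (rule Lim_transform_eventually[OF flat_tendsto_0[of "k + 1"]])
    show "\<forall>\<^sub>F h in at 0. flat (k + 1) h = (flat k h - flat k 0) / (h - 0)"
      by (rule eventually_at_ball'[of 1 _ UNIV, THEN eventually_mono]) (simp_all add: flat_def)
  qed
  then have "(flat k has_real_derivative 0) (at 0)"
    by (simp add: has_field_derivative_iff)
  with equal show ?thesis by (simp add: flat_def)
next
  case greater
  have "((\<lambda>t. exp (- 1 / t) / t ^ k) has_real_derivative
      flat (k + 2) t - real k * flat (k + 1) t) (at t)"
    using greater
    by (auto intro!: derivative_eq_intros simp: flat_def field_simps power2_eq_square)
       (cases k; simp add: field_simps)
  then show ?thesis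
    by (rule has_field_derivative_transform_within_open[of _ _ _ "{0<..}"])
       (use greater in \<open>auto simp: flat_def\<close>)
qed

lemma Ck_on_flat: "Ck_on j UNIV (flat k)"
proof (induction j arbitrary: k)
  case 0
  have "isCont (flat k) t" for t
    using flat_has_derivative[of k t] by (rule DERIV_isCont)
  then show ?case
    by (simp add: continuous_on_eq_continuous_at)
next
  case (Suc j)
  show ?case
  proof (rule Ck_on_SucI)
    show "(flat k has_derivative (\<lambda>v. v * (flat (k + 2) t + (- real k) * flat (k + 1) t))) (at t)" for t
      using flat_has_derivative[of k t] by (simp add: has_field_derivative_def mult_commute_abs)
    show "Ck_on j UNIV (\<lambda>t. v * (flat (k + 2) t + (- real k) * flat (k + 1) t))" for v
      by (intro Ck_on_mult Ck_on_add Ck_on_const Suc.IH open_UNIV)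
  qed simp
qed

lemma exists_bump_function:
  fixes x0 :: "'a::euclidean_space"
  assumes "r > 0"
  obtains \<beta> :: "'a \<Rightarrow> real"
  where "smooth_on UNIV \<beta>" "\<beta> x0 = 1" "\<And>x. x \<notin> ball x0 r \<Longrightarrow> \<beta> x = 0"
proof
  \<comment> \<open>\<open>r^2\<close> minus the squared distance, written as a polynomial in the
    coordinates so that the closure rules apply. It is positive exactly on the ball and equals
    \<open>r^2\<close> at the centre, whence the normalization in \<open>\<beta>\<close>.\<close>
  define G where "G x = r\<^sup>2 - (\<Sum>b\<in>Basis. (x \<bullet> b - x0 \<bullet> b) * (x \<bullet> b - x0 \<bullet> b))" for x
  define \<beta> where "\<beta> x = (1 / flat 0 (r\<^sup>2)) * flat 0 (G x)" for x
  have G: "G x = r\<^sup>2 - (dist x0 x)\<^sup>2" for x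
    unfolding G_def dist_norm norm_minus_commute[of x0] power2_norm_eq_inner
    by (subst euclidean_inner) (simp add: inner_diff_left)
  have pos: "flat 0 (r\<^sup>2) > 0" using assms by (simp add: flat_def)
  have "smooth_on UNIV G"
    unfolding G_def
    by (intro smooth_on_diff smooth_on_const smooth_on_sum smooth_on_mult open_UNIV
        smooth_on_bounded_linear bounded_linear_inner_left)
  then have "smooth_on UNIV (\<lambda>x. flat 0 (G x))"
    by (rule smooth_on_compose[OF open_UNIV subset_UNIV, rotated])
       (simp add: smooth_on_def Ck_on_flat)
  then show "smooth_on UNIV \<beta>"
    unfolding \<beta>_def by (intro smooth_on_mult smooth_on_const open_UNIV)
  show "\<beta> x0 = 1"
    using pos by (simp add: \<beta>_def G)
  show "\<beta> x = 0" if "x \<notin> ball x0 r" for x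
  proof -
    have "r \<le> dist x0 x" using that by simp
    then have "G x \<le> 0" using assms by (simp add: G power_mono)
    then show ?thesis by (simp add: \<beta>_def flat_def)
  qed
qed

subsection \<open>Hadamard's lemma\<close>

text \<open>Differentiating in \<open>x\<close> under the integral produces a factor
  \<open>t\<close>. The weight \<open>t ^ m\<close> closes the family under differentiation, as the
  induction for smoothness requires.\<close>

lemma has_derivative_segment_integral:
  fixes F :: "'a::euclidean_space \<Rightarrow> real"
  assumes F: "smooth_on (ball x0 r) F" and x: "x \<in> ball x0 r"
  shows "((\<lambda>x. integral {0..1} (\<lambda>t. t ^ m * F (x0 + t *\<^sub>R (x - x0)))) has_derivative
    (\<lambda>v. integral {0..1} (\<lambda>t. t ^ (Suc m) *
        frechet_derivative F (at (x0 + t *\<^sub>R (x - x0))) v))) (at x)"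
proof -
  let ?B = "ball x0 r"
  define F' where "F' y = frechet_derivative F (at y)" for y
  have F': "(F has_derivative F' y) (at y)" if "y \<in> ?B" for y
    unfolding F'_def by (rule smooth_on_has_derivative[OF F that])
  have seg: "x0 + t *\<^sub>R (y - x0) \<in> ?B" if "y \<in> ?B" "t \<in> cbox 0 1" for y and t :: real
  proof -
    have "t * dist x0 y \<le> 1 * dist x0 y"
      using that by (intro mult_right_mono) auto
    then show ?thesis
      using that by (auto simp: dist_norm norm_minus_commute[of x0])
  qed
  \<comment> \<open>Packaged as a bounded linear operator because \<open>leibniz_rule\<close> asks
    for joint continuity in operator norm; in finite dimension this can be checked on basis
    vectors.\<close>
  define fx where "fx y t = t ^ (Suc m) *\<^sub>R Blinfun (F' (x0 + t *\<^sub>R (y - x0)))" for y and t :: real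
  have fx: "blinfun_apply (fx y t) v = t ^ (Suc m) * F' (x0 + t *\<^sub>R (y - x0)) v"
    if "y \<in> ?B" "t \<in> cbox 0 1" for y t v
    using bounded_linear_Blinfun_apply[OF has_derivative_bounded_linear[OF F'[OF seg[OF that]]]]
    by (simp add: fx_def scaleR_blinfun.rep_eq)
  have cont_seg: "continuous_on (?B \<times> cbox 0 1) (\<lambda>p. x0 + snd p *\<^sub>R (fst p - x0))"
    by (intro continuous_intros)
  have cont: "continuous_on (?B \<times> cbox 0 1) (\<lambda>p. F' (x0 + snd p *\<^sub>R (fst p - x0)) v)" for v
    using smooth_on_imp_continuous_on[OF smooth_on_frechet_derivative[OF F, of v]] cont_seg
    unfolding F'_def[symmetric]
    by (rule continuous_on_compose2) (use seg in auto)
  have cfx: "continuous_on (?B \<times> cbox 0 1) (\<lambda>(y, t). fx y t)"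
  proof (rule continuous_on_blinfun_componentwise)
    fix i :: 'a
    have "continuous_on (?B \<times> cbox 0 1)
        (\<lambda>p. snd p ^ (Suc m) * F' (x0 + snd p *\<^sub>R (fst p - x0)) i)"
      by (intro continuous_intros cont)
    then show "continuous_on (?B \<times> cbox 0 1) (\<lambda>p. blinfun_apply (case p of (y, t) \<Rightarrow> fx y t) i)"
      by (rule continuous_on_eq) (auto simp: fx simp del: power_Suc)
  qed
  have "((\<lambda>x. integral (cbox 0 1) (\<lambda>t. t ^ m * F (x0 + t *\<^sub>R (x - x0)))) has_derivative
      integral (cbox 0 1) (fx x)) (at x within ?B)"
  proof (rule leibniz_rule[OF _ _ cfx x convex_ball])
    fix y and t :: real assume yt: "y \<in> ?B" "t \<in> cbox 0 1"
    have "((\<lambda>y. F (x0 + t *\<^sub>R (y - x0))) has_derivative (\<lambda>v. F' (x0 + t *\<^sub>R (y - x0)) (t *\<^sub>R v))) (at y)"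
      by (rule has_derivative_compose[where f = "\<lambda>y. x0 + t *\<^sub>R (y - x0)" and g = F])
         (auto intro!: derivative_eq_intros F'[OF seg[OF yt]])
    then have "((\<lambda>y. t ^ m * F (x0 + t *\<^sub>R (y - x0))) has_derivative
        (\<lambda>v. t ^ m * F' (x0 + t *\<^sub>R (y - x0)) (t *\<^sub>R v))) (at y)"
      by (rule has_derivative_mult_right)
    moreover have "(\<lambda>v. t ^ m * F' (x0 + t *\<^sub>R (y - x0)) (t *\<^sub>R v)) = blinfun_apply (fx y t)"
      using linear_scale[OF has_derivative_linear[OF F'[OF seg[OF yt]]]] by (simp add: fx[OF yt] fun_eq_iff)
    ultimately show "((\<lambda>y. t ^ m * F (x0 + t *\<^sub>R (y - x0))) has_derivative blinfun_apply (fx y t)) (at y within ?B)"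
      by (metis has_derivative_at_withinI)
  next
    fix y assume y: "y \<in> ?B"
    have "continuous_on (cbox 0 1) (\<lambda>t::real. F (x0 + t *\<^sub>R (y - x0)))"
      by (rule continuous_on_compose2[OF smooth_on_imp_continuous_on[OF F]])
         (use seg[OF y] in \<open>auto intro!: continuous_intros\<close>)
    then show "(\<lambda>t. t ^ m * F (x0 + t *\<^sub>R (y - x0))) integrable_on cbox 0 1"
      by (intro integrable_continuous continuous_intros)
  qed
  moreover have "blinfun_apply (integral (cbox 0 1) (fx x)) =
      (\<lambda>v. integral (cbox 0 1) (\<lambda>t. t ^ (Suc m) * F' (x0 + t *\<^sub>R (x - x0)) v))"
  proof
    fix v
    have "continuous_on (cbox 0 1) (\<lambda>t::real. (x, t))"
      by (intro continuous_intros)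
    then have "continuous_on (cbox 0 1) (\<lambda>t. case (x, t) of (y, t) \<Rightarrow> fx y t)"
      by (rule continuous_on_compose2[OF cfx]) (use x in auto)
    then have "blinfun_apply (integral (cbox 0 1) (fx x)) v = integral (cbox 0 1) (\<lambda>t. blinfun_apply (fx x t) v)"
      by (intro blinfun_apply_integral integrable_continuous) simp
    also have "\<dots> = integral (cbox 0 1) (\<lambda>t. t ^ (Suc m) * F' (x0 + t *\<^sub>R (x - x0)) v)"
      by (intro integral_cong fx x)
    finally show "blinfun_apply (integral (cbox 0 1) (fx x)) v =
      integral (cbox 0 1) (\<lambda>t. t ^ (Suc m) * F' (x0 + t *\<^sub>R (x - x0)) v)" .
  qed
  ultimately show ?thesis
    using x by (simp add: F'_def cbox_interval at_within_open[OF x open_ball] del: power_Suc)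
qed

lemma smooth_on_segment_integral:
  fixes F :: "'a::euclidean_space \<Rightarrow> real"
  assumes "smooth_on (ball x0 r) F"
  shows "smooth_on (ball x0 r) (\<lambda>x. integral {0..1} (\<lambda>t. F (x0 + t *\<^sub>R (x - x0))))"
proof -
  have "Ck_on k (ball x0 r) (\<lambda>x. integral {0..1} (\<lambda>t. t ^ m * F (x0 + t *\<^sub>R (x - x0))))"
    if "smooth_on (ball x0 r) F" for k m and F :: "'a \<Rightarrow> real"
    using that
  proof (induction k arbitrary: m F)
    case 0
    then show ?case
      using has_derivative_continuous[OF has_derivative_segment_integral[OF 0]]
      by (simp add: continuous_at_imp_continuous_on)
  next
    case (Suc k)
    show ?case
      by (rule Ck_on_SucI[OF open_ball has_derivative_segment_integral[OF Suc.prems]])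
         (simp_all only: Suc.IH[OF smooth_on_frechet_derivative[OF Suc.prems]])
  qed
  from this[OF assms, of _ 0] show ?thesis
    by (simp add: smooth_on_def)
qed

text \<open>Integrate the derivative of \<open>f\<close> along the segment from \<open>x0\<close> to
  \<open>x\<close>: \<open>h b\<close> is the mean over that segment of the partial derivative in
  direction \<open>b\<close>.\<close>

lemma hadamard:
  fixes f :: "'a::euclidean_space \<Rightarrow> real"
  assumes f: "smooth_on (ball x0 r) f" and r: "r > 0"
  obtains h where "\<And>b. smooth_on (ball x0 r) (h b)"
    "\<And>b. h b x0 = frechet_derivative f (at x0) b"
    "\<And>x. x \<in> ball x0 r \<Longrightarrow> f x = f x0 + (\<Sum>b\<in>Basis. ((x - x0) \<bullet> b) * h b x)"
proof
  let ?f' = "\<lambda>y. frechet_derivative f (at y)"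
  define h where "h b x = integral {0..1} (\<lambda>t. ?f' (x0 + t *\<^sub>R (x - x0)) b)" for b x
  show "smooth_on (ball x0 r) (h b)" for b
    unfolding h_def
    by (rule smooth_on_segment_integral[OF smooth_on_frechet_derivative[OF f]])
  show "h b x0 = ?f' x0 b" for b
    by (simp add: h_def)
  fix x assume x: "x \<in> ball x0 r"
  have seg: "x0 + t *\<^sub>R (x - x0) \<in> ball x0 r" if "t \<in> {0..1}" for t :: real
  proof -
    have "t * dist x0 x \<le> 1 * dist x0 x"
      using that by (intro mult_right_mono) auto
    then show ?thesis
      using that x by (auto simp: dist_norm norm_minus_commute[of x0])
  qed
  have "((\<lambda>t. ?f' (x0 + t *\<^sub>R (x - x0)) (x - x0)) has_integral
      f (x0 + 1 *\<^sub>R (x - x0)) - f (x0 + 0 *\<^sub>R (x - x0))) {0..1}"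
  proof (rule fundamental_theorem_of_calculus)
    fix t :: real assume t: "t \<in> {0..1}"
    have f': "(f has_derivative ?f' (x0 + t *\<^sub>R (x - x0))) (at (x0 + t *\<^sub>R (x - x0)))"
      by (rule smooth_on_has_derivative[OF f seg[OF t]])
    have "((\<lambda>t. f (x0 + t *\<^sub>R (x - x0))) has_derivative
        (\<lambda>s. ?f' (x0 + t *\<^sub>R (x - x0)) (s *\<^sub>R (x - x0)))) (at t)"
      by (rule has_derivative_compose[where f = "\<lambda>t. x0 + t *\<^sub>R (x - x0)" and g = f])
         (auto intro!: derivative_eq_intros f')
    moreover have "(\<lambda>s. ?f' (x0 + t *\<^sub>R (x - x0)) (s *\<^sub>R (x - x0))) =
        (\<lambda>s. s *\<^sub>R ?f' (x0 + t *\<^sub>R (x - x0)) (x - x0))"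
      using linear_scale[OF has_derivative_linear[OF f']] by (simp add: fun_eq_iff)
    ultimately show "((\<lambda>t. f (x0 + t *\<^sub>R (x - x0))) has_vector_derivative
        ?f' (x0 + t *\<^sub>R (x - x0)) (x - x0)) (at t within {0..1})"
      by (auto simp: has_vector_derivative_def intro: has_derivative_at_withinI)
  qed simp
  then have "f x - f x0 = integral {0..1} (\<lambda>t. ?f' (x0 + t *\<^sub>R (x - x0)) (x - x0))"
    by (simp add: integral_unique)
  also have "\<dots> = integral {0..1} (\<lambda>t. \<Sum>b\<in>Basis. ((x - x0) \<bullet> b) * ?f' (x0 + t *\<^sub>R (x - x0)) b)"
  proof (rule integral_cong)
    fix t :: real assume "t \<in> {0..1}"
    from Linear_Algebra.linear_componentwise[OF has_derivative_linear[OF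
        smooth_on_has_derivative[OF f seg[OF this]]], of "x - x0" 1]
    show "?f' (x0 + t *\<^sub>R (x - x0)) (x - x0) =
        (\<Sum>b\<in>Basis. ((x - x0) \<bullet> b) * ?f' (x0 + t *\<^sub>R (x - x0)) b)" by simp
  qed
  also have "\<dots> = (\<Sum>b\<in>Basis. integral {0..1} (\<lambda>t. ((x - x0) \<bullet> b) * ?f' (x0 + t *\<^sub>R (x - x0)) b))"
  proof (rule integral_sum)
    fix b :: 'a
    have "continuous_on {0..1} (\<lambda>t::real. ?f' (x0 + t *\<^sub>R (x - x0)) b)"
      by (rule continuous_on_compose2[OF smooth_on_imp_continuous_on[OF
              smooth_on_frechet_derivative[OF f]]])
         (use seg in \<open>auto intro!: continuous_intros\<close>)
    then show "(\<lambda>t. ((x - x0) \<bullet> b) * ?f' (x0 + t *\<^sub>R (x - x0)) b) integrable_on {0..1}"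
      by (intro integrable_continuous_real continuous_intros)
  qed simp
  finally show "f x = f x0 + (\<Sum>b\<in>Basis. ((x - x0) \<bullet> b) * h b x)"
    by (simp add: h_def)
qed

subsection \<open>Charts, cutoffs and coordinate vector fields\<close>

lemma is_chartD:
  assumes "is_chart (U, \<phi>)"
  shows "open U" "open (\<phi> ` U)" "inj_on \<phi> U" "continuous_on U \<phi>"
    "continuous_on (\<phi> ` U) (inv_into U \<phi>)"
  using assms by (auto simp: is_chart_def homeomorphism_def intro: inj_on_inverseI)

lemma is_chart_open_image:
  assumes "is_chart (U, \<phi>)" "open W"
  shows "open (\<phi> ` (U \<inter> W))"
proof -
  have "\<phi> ` (U \<inter> W) = inv_into U \<phi> -` W \<inter> \<phi> ` U"
    using is_chartD(3)[OF assms(1)] by auto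
  then show ?thesis
    using continuous_on_open_vimage[OF is_chartD(2)[OF assms(1)]] is_chartD(5)[OF assms(1)] assms(2)
    by metis
qed

definition cutoff :: "'m set \<Rightarrow> ('m \<Rightarrow> 'e) \<Rightarrow> ('e \<Rightarrow> real) \<Rightarrow> 'm \<Rightarrow> real" where
  "cutoff U \<phi> h q = (if q \<in> U then h (\<phi> q) else 0)"

locale smooth_manifold =
  fixes A :: "('m::{t2_space, second_countable_topology}, 'e::euclidean_space) atlas"
  assumes atlas: "smooth_atlas A"
begin

abbreviation "SF \<equiv> smooth_functions A"
abbreviation "VF \<equiv> vfields A"
abbreviation "T \<equiv> tangent_space A"

lemma chart: "(U, \<phi>) \<in> A \<Longrightarrow> is_chart (U, \<phi>)"
  using atlas by (auto simp: smooth_atlas_def)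

lemma transition_smooth:
  "(U, \<phi>) \<in> A \<Longrightarrow> (V, \<psi>) \<in> A \<Longrightarrow> smooth_on (\<phi> ` (U \<inter> V)) (\<psi> \<circ> inv_into U \<phi>)"
  using atlas by (auto simp: smooth_atlas_def)

lemma SF_I:
  assumes "\<And>U \<phi>. (U, \<phi>) \<in> A \<Longrightarrow> smooth_on (\<phi> ` U) (\<lambda>x. f (inv_into U \<phi> x))"
  shows "f \<in> SF"
  using assms by (auto simp: smooth_functions_def comp_def)

lemma SF_D: "f \<in> SF \<Longrightarrow> (U, \<phi>) \<in> A \<Longrightarrow> smooth_on (\<phi> ` U) (\<lambda>x. f (inv_into U \<phi> x))"
  by (auto simp: smooth_functions_def comp_def)

lemma SF_const [simp, intro]: "(\<lambda>q. c) \<in> SF"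
  by (rule SF_I) (rule smooth_on_const)

lemma SF_add [simp, intro]: "f \<in> SF \<Longrightarrow> h \<in> SF \<Longrightarrow> (\<lambda>q. f q + h q) \<in> SF"
  by (rule SF_I) (intro smooth_on_add is_chartD(2) chart SF_D)

lemma SF_mult [simp, intro]: "f \<in> SF \<Longrightarrow> h \<in> SF \<Longrightarrow> (\<lambda>q. f q * h q) \<in> SF"
  by (rule SF_I) (intro smooth_on_mult is_chartD(2) chart SF_D)

lemma SF_diff [simp, intro]: "f \<in> SF \<Longrightarrow> h \<in> SF \<Longrightarrow> (\<lambda>q. f q - h q) \<in> SF"
  by (rule SF_I) (intro smooth_on_diff is_chartD(2) chart SF_D)

lemma SF_uminus [simp, intro]: "f \<in> SF \<Longrightarrow> (\<lambda>q. - f q) \<in> SF"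
  using SF_diff[OF SF_const[of 0]] by simp

lemma SF_sum [intro]: "(\<And>i. i \<in> I \<Longrightarrow> f i \<in> SF) \<Longrightarrow> (\<lambda>q. \<Sum>i\<in>I. f i q) \<in> SF"
  by (rule SF_I) (intro smooth_on_sum is_chartD(2) chart SF_D)

lemma SF_prod [intro]: "(\<And>i. i \<in> I \<Longrightarrow> f i \<in> SF) \<Longrightarrow> (\<lambda>q. \<Prod>i\<in>I. f i q) \<in> SF"
  by (induction I rule: infinite_finite_induct) auto

text \<open>Two open sets cover the manifold: the points of \<open>U\<close> that
  \<open>\<phi>\<close> sends into \<open>W\<close>, where the function is \<open>h\<close> after a
  transition map, and the complement of the preimage of \<open>K\<close>, where it is zero. The
  preimage is compact, hence closed by the Hausdorff property.\<close>

lemma cutoff_smooth: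
  assumes U: "(U, \<phi>) \<in> A" and K: "compact K" "K \<subseteq> \<phi> ` U" and W: "open W" "K \<subseteq> W"
    and h: "smooth_on W h" "\<And>x. x \<notin> K \<Longrightarrow> h x = 0"
  shows "cutoff U \<phi> h \<in> SF"
proof (rule SF_I)
  fix V \<psi> assume V: "(V, \<psi>) \<in> A"
  define K' where "K' = inv_into U \<phi> ` K"
  note cU = is_chartD[OF chart[OF U]] and cV = is_chartD[OF chart[OF V]]
  have "compact K'"
    unfolding K'_def using K cU(5) by (meson compact_continuous_image continuous_on_subset)
  then have "closed K'" by (rule compact_imp_closed)
  have W1: "open (U \<inter> \<phi> -` W)"
    using continuous_on_open_vimage[OF cU(1)] cU(4) W(1) by (metis Int_commute)
  show "smooth_on (\<psi> ` V) (\<lambda>x. cutoff U \<phi> h (inv_into V \<psi> x))"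
  proof (rule smooth_on_local)
    fix y assume "y \<in> \<psi> ` V"
    then obtain q where q: "q \<in> V" "y = \<psi> q" by blast
    show "\<exists>T. open T \<and> y \<in> T \<and> smooth_on T (\<lambda>x. cutoff U \<phi> h (inv_into V \<psi> x))"
    proof (cases "q \<in> K'")
      case True
      let ?T = "\<psi> ` (V \<inter> (U \<inter> \<phi> -` W))"
      have "q \<in> U" "\<phi> q \<in> W"
        using True K W(2) by (auto simp: K'_def inv_into_into f_inv_into_f subset_iff)
      then have "y \<in> ?T" using q by auto
      moreover have oT: "open ?T"
        by (rule is_chart_open_image[OF chart[OF V] W1])
      moreover have "smooth_on ?T (\<lambda>x. h ((\<phi> \<circ> inv_into V \<psi>) x))"
        by (rule smooth_on_compose[OF oT _ h(1)
              smooth_on_subset[OF transition_smooth[OF V U]]])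
           (use cV(3) in auto)
      then have "smooth_on ?T (\<lambda>x. cutoff U \<phi> h (inv_into V \<psi> x))"
        by (rule smooth_on_cong_open[OF oT, rotated])
           (use cV(3) in \<open>auto simp: cutoff_def\<close>)
      ultimately show ?thesis by blast
    next
      case False
      let ?T = "\<psi> ` (V \<inter> - K')"
      have "y \<in> ?T" using q False by auto
      moreover have oT: "open ?T"
        using \<open>closed K'\<close> by (intro is_chart_open_image[OF chart[OF V]] open_Compl)
      moreover have "cutoff U \<phi> h q' = 0" if "q' \<notin> K'" for q'
        using that h(2) cU(3) unfolding cutoff_def K'_def
        by (metis imageI inv_into_f_f)
      then have "smooth_on ?T (\<lambda>x. cutoff U \<phi> h (inv_into V \<psi> x))"
        by (intro smooth_on_cong_open[OF oT _ smooth_on_const[of _ 0]])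
           (use cV(3) in auto)
      ultimately show ?thesis by blast
    qed
  qed
qed

section \<open>Calculus of derivations at a point\<close>

lemma tangent_add: "v \<in> T p \<Longrightarrow> f \<in> SF \<Longrightarrow> h \<in> SF \<Longrightarrow> v (\<lambda>q. f q + h q) = v f + v h"
  by (simp add: tangent_space_def)

lemma tangent_scale: "v \<in> T p \<Longrightarrow> f \<in> SF \<Longrightarrow> v (\<lambda>q. c * f q) = c * v f"
  by (simp add: tangent_space_def)

lemma tangent_mult:
  "v \<in> T p \<Longrightarrow> f \<in> SF \<Longrightarrow> h \<in> SF \<Longrightarrow> v (\<lambda>q. f q * h q) = v f * h p + f p * v h"
  by (simp add: tangent_space_def)

lemma tangent_nonsmooth: "v \<in> T p \<Longrightarrow> f \<notin> SF \<Longrightarrow> v f = 0"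
  by (simp add: tangent_space_def)

lemma tangent_const: "v \<in> T p \<Longrightarrow> v (\<lambda>q. c) = 0"
  using tangent_mult[of v p "\<lambda>_. 1" "\<lambda>_. 1"] tangent_scale[of v p "\<lambda>_. 1" c] by simp

lemma tangent_diff: "v \<in> T p \<Longrightarrow> f \<in> SF \<Longrightarrow> h \<in> SF \<Longrightarrow> v (\<lambda>q. f q - h q) = v f - v h"
  using tangent_add[of v p f "\<lambda>q. (-1) * h q"] tangent_scale[of v p h "-1"] by simp

lemma tangent_sum:
  "v \<in> T p \<Longrightarrow> (\<And>i. i \<in> I \<Longrightarrow> f i \<in> SF) \<Longrightarrow> v (\<lambda>q. \<Sum>i\<in>I. f i q) = (\<Sum>i\<in>I. v (f i))"
proof (induction I rule: infinite_finite_induct)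
  case (insert i I)
  then have "(\<lambda>q. \<Sum>i\<in>I. f i q) \<in> SF" by (intro SF_sum) simp
  with insert show ?case by (simp add: tangent_add[OF \<open>v \<in> T p\<close>])
qed (simp_all add: tangent_const)

lemma tangent_prod_unit:
  assumes "v \<in> T p" "finite I" "\<And>i. i \<in> I \<Longrightarrow> f i \<in> SF" "\<And>i. i \<in> I \<Longrightarrow> f i p = 1"
  shows "v (\<lambda>q. \<Prod>i\<in>I. f i q) = (\<Sum>i\<in>I. v (f i))"
  using assms(2,3,4)
proof (induction I rule: finite_induct)
  case (insert i I)
  then have "(\<lambda>q. \<Prod>i\<in>I. f i q) \<in> SF" by (intro SF_prod) simp
  with insert show ?case by (simp add: tangent_mult[OF assms(1)])
qed (simp add: tangent_const[OF assms(1)])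

end

lemma sum_fun_apply: "(\<Sum>i\<in>I. F i) x = (\<Sum>i\<in>I. F i x)"
  for F :: "'i \<Rightarrow> 'x \<Rightarrow> 'y::comm_monoid_add"
  by (induction I rule: infinite_finite_induct) (simp_all add: zero_fun_def)

text \<open>\<open>\<beta>\<close> lives on half the radius, so the closed ball of radius
  \<open>R / 2\<close> is a compact set inside the ball of radius \<open>R\<close> on which local
  functions are smooth. This margin is what \<open>cutoff_smooth\<close> asks for.\<close>

locale bump_chart = smooth_manifold A
  for A :: "('m::{t2_space, second_countable_topology}, 'e::euclidean_space) atlas" +
  fixes U :: "'m set" and \<phi> :: "'m \<Rightarrow> 'e" and p :: 'm and \<beta> :: "'e \<Rightarrow> real" and R :: real
  assumes U: "(U, \<phi>) \<in> A" and p: "p \<in> U" and R: "R > 0" "ball (\<phi> p) R \<subseteq> \<phi> ` U"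
    and \<beta>: "smooth_on UNIV \<beta>" "\<beta> (\<phi> p) = 1" "\<And>x. x \<notin> ball (\<phi> p) (R / 2) \<Longrightarrow> \<beta> x = 0"
begin

lemma inv_chart [simp]: "q \<in> U \<Longrightarrow> inv_into U \<phi> (\<phi> q) = q"
  using is_chartD(3)[OF chart[OF U]] by simp

lemma open_chart: "open (\<phi> ` U)"
  by (rule is_chartD(2)[OF chart[OF U]])

lemma cut_smooth:
  assumes "smooth_on (ball (\<phi> p) R) h"
  shows "cutoff U \<phi> (\<lambda>x. \<beta> x * h x) \<in> SF"
proof (rule cutoff_smooth[OF U, where W = "ball (\<phi> p) R" and K = "cball (\<phi> p) (R / 2)"])
  have sub: "cball (\<phi> p) (R / 2) \<subseteq> ball (\<phi> p) R" using R(1) by auto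
  then show "cball (\<phi> p) (R / 2) \<subseteq> ball (\<phi> p) R" .
  show "cball (\<phi> p) (R / 2) \<subseteq> \<phi> ` U" using sub R(2) by blast
  show "smooth_on (ball (\<phi> p) R) (\<lambda>x. \<beta> x * h x)"
    by (intro smooth_on_mult open_ball assms smooth_on_subset[OF \<beta>(1)]) simp
  show "\<beta> x * h x = 0" if "x \<notin> cball (\<phi> p) (R / 2)" for x
    using that \<beta>(3)[of x] by auto
qed auto

text \<open>Derivations act on global functions only, hence the cut-off versions \<open>bump\<close>
  of 1 and \<open>y b\<close> of the coordinates centred at \<open>p\<close>. \<open>dir\<close> is
  the directional derivative in the chart and \<open>coord_field u\<close> is \<open>\<beta>\<close>
  times the coordinate field of \<open>u\<close>; its value 0 on non-smooth functions is forced by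
  \<open>tangent_space\<close>.\<close>

definition "bump = cutoff U \<phi> \<beta>"
definition "y b = cutoff U \<phi> (\<lambda>x. \<beta> x * ((x - \<phi> p) \<bullet> b))"
definition "dir f x u = frechet_derivative (\<lambda>x. f (inv_into U \<phi> x)) (at x) u"
definition "coord_field u q f = (if f \<in> SF then cutoff U \<phi> (\<lambda>x. \<beta> x * dir f x u) q else 0)"

lemma smooth_coord: "smooth_on S (\<lambda>x. (x - \<phi> p) \<bullet> b)" if "open S"
  unfolding inner_diff_left
  by (intro smooth_on_diff smooth_on_const smooth_on_bounded_linear bounded_linear_inner_left that)

lemma bump_SF [simp]: "bump \<in> SF"
  using cut_smooth[OF smooth_on_const[of _ 1]] by (simp add: bump_def)

lemma y_SF [simp]: "y b \<in> SF"
  unfolding y_def by (rule cut_smooth[OF smooth_coord[OF open_ball]])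

lemma bump_p [simp]: "bump p = 1"
  using p by (simp add: bump_def cutoff_def \<beta>)

lemma y_p [simp]: "y b p = 0"
  using p by (simp add: y_def cutoff_def)

lemma dir_has_derivative:
  assumes "f \<in> SF" "q \<in> U"
  shows "((\<lambda>x. f (inv_into U \<phi> x)) has_derivative dir f (\<phi> q)) (at (\<phi> q))"
  using smooth_on_has_derivative[OF SF_D[OF assms(1) U], of "\<phi> q"] assms(2)
  by (simp add: dir_def[abs_def])

lemma dirI:
  assumes "q \<in> U" "((\<lambda>x. h x) has_derivative h') (at (\<phi> q))"
    and "\<And>x. x \<in> \<phi> ` U \<Longrightarrow> f (inv_into U \<phi> x) = h x"
  shows "dir f (\<phi> q) = h'"
proof -
  have "((\<lambda>x. f (inv_into U \<phi> x)) has_derivative h') (at (\<phi> q))"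
    by (rule has_derivative_transform_within_open[OF assms(2) open_chart])
       (use assms(1,3) in auto)
  then show ?thesis
    unfolding dir_def by (metis frechet_derivative_at)
qed

lemma dir_linear: "f \<in> SF \<Longrightarrow> q \<in> U \<Longrightarrow> linear (dir f (\<phi> q))"
  using dir_has_derivative has_derivative_linear by blast

lemma dir_bump: "q \<in> U \<Longrightarrow> dir bump (\<phi> q) u = frechet_derivative \<beta> (at (\<phi> q)) u"
  by (subst dirI[OF _ smooth_on_has_derivative[OF \<beta>(1)]])
     (auto simp: bump_def cutoff_def)

lemma dir_y:
  assumes "q \<in> U"
  shows "dir (y b) (\<phi> q) u =
    \<beta> (\<phi> q) * (u \<bullet> b) + frechet_derivative \<beta> (at (\<phi> q)) u * ((\<phi> q - \<phi> p) \<bullet> b)"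
proof -
  have "((\<lambda>x. \<beta> x * ((x - \<phi> p) \<bullet> b)) has_derivative
     (\<lambda>u. \<beta> (\<phi> q) * (u \<bullet> b) + frechet_derivative \<beta> (at (\<phi> q)) u * ((\<phi> q - \<phi> p) \<bullet> b))) (at (\<phi> q))"
    by (rule has_derivative_mult[OF smooth_on_has_derivative[OF \<beta>(1)]])
       (auto intro!: derivative_eq_intros)
  then have "dir (y b) (\<phi> q) =
     (\<lambda>u. \<beta> (\<phi> q) * (u \<bullet> b) + frechet_derivative \<beta> (at (\<phi> q)) u * ((\<phi> q - \<phi> p) \<bullet> b))"
    by (rule dirI[OF assms]) (auto simp: y_def cutoff_def)
  then show ?thesis by simp
qed

lemma dir_smooth: "f \<in> SF \<Longrightarrow> smooth_on (ball (\<phi> p) R) (\<lambda>x. dir f x u)"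
  unfolding dir_def
  by (rule smooth_on_subset[OF smooth_on_frechet_derivative[OF SF_D[OF _ U]] R(2)])

lemma coord_field_VF: "coord_field u \<in> VF"
proof -
  have "coord_field u q \<in> T q" for q
  proof (cases "q \<in> U")
    case True
    have "dir (\<lambda>q. f q + h q) (\<phi> q) = (\<lambda>u. dir f (\<phi> q) u + dir h (\<phi> q) u)"
      if "f \<in> SF" "h \<in> SF" for f h
      by (rule dirI[OF True has_derivative_add[OF dir_has_derivative dir_has_derivative]])
         (use that True in auto)
    moreover have "dir (\<lambda>q. c * f q) (\<phi> q) = (\<lambda>u. c * dir f (\<phi> q) u)"
      if "f \<in> SF" for f c
      by (rule dirI[OF True has_derivative_mult_right[OF dir_has_derivative]])
         (use that True in auto)
    moreover have "dir (\<lambda>q. f q * h q) (\<phi> q) = (\<lambda>u. f q * dir h (\<phi> q) u + dir f (\<phi> q) u * h q)"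
      if "f \<in> SF" "h \<in> SF" for f h
      using dirI[OF True has_derivative_mult[OF dir_has_derivative dir_has_derivative], of f h "\<lambda>q. f q * h q"]
        that True by simp
    ultimately show ?thesis
      using True by (auto simp: tangent_space_def coord_field_def cutoff_def algebra_simps)
  qed (auto simp: tangent_space_def coord_field_def cutoff_def)
  moreover have "(\<lambda>q. coord_field u q f) \<in> SF" if "f \<in> SF" for f
    using cut_smooth[OF dir_smooth[OF that]] that by (simp add: coord_field_def)
  ultimately show ?thesis
    by (simp add: vfields_def)
qed

text \<open>Apply \<open>v\<close> to Hadamard's formula made global by the factor
  \<open>bump\<close> squared. The derivatives of \<open>bump\<close> cancel between the two sides,
  and since \<open>y b\<close> vanishes at \<open>p\<close> only \<open>v (y b)\<close> times a
  partial derivative of \<open>f\<close> remains.\<close>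

lemma tangent_rep_center:
  assumes v: "v \<in> T p"
  obtains u where "\<And>f. f \<in> SF \<Longrightarrow> v f = dir f (\<phi> p) u"
proof
  fix f assume f: "f \<in> SF"
  let ?F = "\<lambda>x. f (inv_into U \<phi> x)"
  have "smooth_on (ball (\<phi> p) R) ?F"
    by (rule smooth_on_subset[OF SF_D[OF f U] R(2)])
  then obtain h where h: "\<And>b. smooth_on (ball (\<phi> p) R) (h b)"
      "\<And>b. h b (\<phi> p) = dir f (\<phi> p) b"
      "\<And>x. x \<in> ball (\<phi> p) R \<Longrightarrow> ?F x = ?F (\<phi> p) + (\<Sum>b\<in>Basis. ((x - \<phi> p) \<bullet> b) * h b x)"
    unfolding dir_def by (rule hadamard[OF _ R(1)]) blast
  define H where "H b = cutoff U \<phi> (\<lambda>x. \<beta> x * h b x)" for b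
  have H: "H b \<in> SF" for b
    unfolding H_def by (rule cut_smooth[OF h(1)])
  have Hp: "H b p = dir f (\<phi> p) b" for b
    using p by (simp add: H_def cutoff_def \<beta> h(2))
  \<comment> \<open>Two factors \<open>bump\<close> are needed: \<open>y b\<close> and
    \<open>H b\<close> carry one each.\<close>
  have "bump q * (bump q * f q) = f p * (bump q * bump q) + (\<Sum>b\<in>Basis. y b q * H b q)" for q
  proof (cases "q \<in> U \<and> \<phi> q \<in> ball (\<phi> p) R")
    case True
    then show ?thesis
      using h(3)[of "\<phi> q"] p
      by (simp add: bump_def y_def H_def cutoff_def algebra_simps sum_distrib_left)
  next
    case False
    then have "bump q = 0" "y b q = 0" for b
      using \<beta>(3)[of "\<phi> q"] R(1) by (auto simp: bump_def y_def cutoff_def)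
    then show ?thesis by simp
  qed
  then have "v (\<lambda>q. bump q * (bump q * f q)) =
      v (\<lambda>q. f p * (bump q * bump q) + (\<Sum>b\<in>Basis. y b q * H b q))"
    by simp
  then have "v f = (\<Sum>b\<in>Basis. v (y b) * dir f (\<phi> p) b)"
    using f H by (simp add: tangent_add[OF v] tangent_mult[OF v] tangent_scale[OF v]
        tangent_sum[OF v] tangent_const[OF v] SF_sum Hp algebra_simps)
  also have "\<dots> = dir f (\<phi> p) (\<Sum>b\<in>Basis. v (y b) *\<^sub>R b)"
    using dir_linear[OF f p] by (simp add: linear_sum linear_scale)
  finally show "v f = dir f (\<phi> p) (\<Sum>b\<in>Basis. v (y b) *\<^sub>R b)" .
qed

end

context smooth_manifold begin

lemma exists_bump_chart:
  assumes "(U, \<phi>) \<in> A" "p \<in> U"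
  obtains \<beta> R where "bump_chart A U \<phi> p \<beta> R"
proof -
  have "open (\<phi> ` U)" "\<phi> p \<in> \<phi> ` U"
    using is_chartD(2)[OF chart[OF assms(1)]] assms(2) by auto
  then obtain R where R: "R > 0" "ball (\<phi> p) R \<subseteq> \<phi> ` U"
    using open_contains_ball by blast
  then obtain \<beta> :: "'e \<Rightarrow> real" where
    "smooth_on UNIV \<beta>" "\<beta> (\<phi> p) = 1" "\<And>x. x \<notin> ball (\<phi> p) (R / 2) \<Longrightarrow> \<beta> x = 0"
    using exists_bump_function[of "R / 2" "\<phi> p"] by auto
  with assms R have "bump_chart A U \<phi> p \<beta> R"
    by unfold_locales auto
  then show ?thesis by (rule that)
qed

end

context bump_chart begin

text \<open>\<open>dir\<close> depends on the chart only, so the bump may be recentred at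
  \<open>q\<close> within the same chart.\<close>

lemma tangent_rep:
  assumes "q \<in> U" "v \<in> T q"
  obtains u where "\<And>f. f \<in> SF \<Longrightarrow> v f = dir f (\<phi> q) u"
proof -
  obtain \<beta>' R' where "bump_chart A U \<phi> q \<beta>' R'"
    using exists_bump_chart[OF U assms(1)] .
  then interpret q: bump_chart A U \<phi> q \<beta>' R' .
  obtain u where "\<And>f. f \<in> SF \<Longrightarrow> v f = q.dir f (\<phi> q) u"
    using q.tangent_rep_center[OF assms(2)] by blast
  then show ?thesis
    by (intro that[of u]) (simp add: dir_def q.dir_def)
qed

lemma coord_field_add: "coord_field (u + w) = coord_field u + coord_field w"
  by (auto simp: fun_eq_iff coord_field_def cutoff_def linear_add[OF dir_linear] algebra_simps)

lemma coord_field_scale: "coord_field (c *\<^sub>R u) = fscale (\<lambda>_. c) (coord_field u)"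
  by (auto simp: fun_eq_iff coord_field_def cutoff_def fscale_def tscale_def
      linear_scale[OF dir_linear])

lemma coord_field_surj:
  assumes v: "v \<in> T p"
  obtains u where "v = coord_field u p"
proof -
  obtain u where "\<And>f. f \<in> SF \<Longrightarrow> v f = dir f (\<phi> p) u"
    using tangent_rep[OF p v] by blast
  then have "v = coord_field u p"
    using p tangent_nonsmooth[OF v]
    by (auto simp: fun_eq_iff coord_field_def cutoff_def \<beta>)
  then show ?thesis by (rule that)
qed

lemma coord_field_inj:
  assumes "coord_field u p = 0"
  shows "u = 0"
proof (rule euclidean_eqI)
  fix b :: 'e
  have "coord_field u p (y b) = u \<bullet> b"
    using p by (simp add: coord_field_def cutoff_def dir_y \<beta>)
  with assms show "u \<bullet> b = 0 \<bullet> b" by simp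
qed

text \<open>With \<open>x\<^sub>b\<close> the coordinates centred at \<open>p\<close>, the coefficient is \<open>bump\<^sup>2 X(x\<^sub>b)\<close>, rewritten
  in terms of the globally defined functions \<open>bump\<close> and \<open>y b = bump x\<^sub>b\<close>.\<close>

lemma coord_field_expansion:
  assumes X: "X \<in> VF"
  shows "fscale (\<lambda>q. bump q * (bump q * bump q)) X =
    (\<Sum>b\<in>Basis. fscale (\<lambda>q. bump q * X q (y b) - y b q * X q bump) (coord_field b))"
proof (intro ext)
  fix q f
  have Xq: "X q \<in> T q" using X by (simp add: vfields_def)
  show "fscale (\<lambda>q. bump q * (bump q * bump q)) X q f =
    (\<Sum>b\<in>Basis. fscale (\<lambda>q. bump q * X q (y b) - y b q * X q bump) (coord_field b)) q f"
  proof (cases "q \<in> U \<and> f \<in> SF")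
    case True
    obtain u where u: "\<And>f. f \<in> SF \<Longrightarrow> X q f = dir f (\<phi> q) u"
      using tangent_rep[OF _ Xq] True by blast
    have "dir f (\<phi> q) u = (\<Sum>b\<in>Basis. (u \<bullet> b) * dir f (\<phi> q) b)"
      using Linear_Algebra.linear_componentwise[OF dir_linear, of f q u 1] True by simp
    moreover have \<beta>q: "bump q = \<beta> (\<phi> q)" "y b q = \<beta> (\<phi> q) * ((\<phi> q - \<phi> p) \<bullet> b)" for b
      using True by (simp_all add: bump_def y_def cutoff_def)
    \<comment> \<open>This is the numerator of the quotient rule for \<open>y b / bump\<close>: the
      terms with the derivative of \<open>\<beta>\<close> cancel. The third factor
      \<open>bump\<close> of the claim comes from \<open>coord_field\<close>.\<close>
    moreover have "bump q * X q (y b) - y b q * X q bump = \<beta> (\<phi> q) * (\<beta> (\<phi> q) * (u \<bullet> b))" for b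
      using True unfolding \<beta>q u[OF y_SF] u[OF bump_SF]
      by (simp only: dir_y dir_bump) (simp add: algebra_simps)
    moreover have "coord_field b q f = \<beta> (\<phi> q) * dir f (\<phi> q) b" for b
      using True by (simp add: coord_field_def cutoff_def)
    ultimately show ?thesis
      using True
      by (simp add: sum_fun_apply fscale_def tscale_def u sum_distrib_left mult_ac del: y_p)
  next
    case False
    then have "coord_field b q f = 0" for b
      by (auto simp: coord_field_def cutoff_def)
    moreover have "bump q = 0 \<or> X q f = 0"
      using False tangent_nonsmooth[OF Xq] by (auto simp: bump_def cutoff_def)
    ultimately show ?thesis
      by (auto simp: sum_fun_apply fscale_def tscale_def)
  qed
qed

end

context smooth_manifold begin

text \<open>Everything that later arguments take from charts: global fields, linear in
  \<open>u\<close>, whose values at \<open>p\<close> identify the model space with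
  \<open>T p\<close>, and an expansion of any field after multiplication by \<open>bump\<close>.
  That the coefficients vanish at \<open>p\<close> together with \<open>X\<close> is the key to
  pointwise dependence of tensors.\<close>

lemma obtain_coord_fields:
  obtains C :: "'e \<Rightarrow> 'm vfield" and bump where
    "\<And>u. C u \<in> VF" "\<And>u w. C (u + w) = C u + C w" "\<And>c u. C (c *\<^sub>R u) = fscale (\<lambda>_. c) (C u)"
    "\<And>v. v \<in> T p \<Longrightarrow> \<exists>u. v = C u p" "\<And>u. C u p = 0 \<Longrightarrow> u = 0"
    "bump \<in> SF" "bump p = 1"
    "\<And>X. X \<in> VF \<Longrightarrow> \<exists>a. (\<forall>b. a b \<in> SF \<and> (X p = 0 \<longrightarrow> a b p = 0)) \<and>
        fscale bump X = (\<Sum>b\<in>Basis. fscale (a b) (C b))"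
proof -
  have "p \<in> (\<Union>c\<in>A. fst c)"
    using atlas by (simp add: smooth_atlas_def)
  then obtain U \<phi> where U: "(U, \<phi>) \<in> A" "p \<in> U"
    by auto
  obtain \<beta> R where "bump_chart A U \<phi> p \<beta> R"
    using exists_bump_chart[OF U] .
  then interpret bump_chart A U \<phi> p \<beta> R .
  show ?thesis
  proof (rule that[of coord_field "\<lambda>q. bump q * (bump q * bump q)"])
    show "\<exists>u. v = coord_field u p" if "v \<in> T p" for v
      using coord_field_surj[OF that] by blast
    fix X assume X: "X \<in> VF"
    then have "(\<lambda>q. X q f) \<in> SF" if "f \<in> SF" for f
      using that by (simp add: vfields_def)
    then show "\<exists>a. (\<forall>b. a b \<in> SF \<and> (X p = 0 \<longrightarrow> a b p = 0)) \<and>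
        fscale (\<lambda>q. bump q * (bump q * bump q)) X = (\<Sum>b\<in>Basis. fscale (a b) (coord_field b))"
      by (intro exI[of _ "\<lambda>b q. bump q * X q (y b) - y b q * X q bump"])
         (auto simp: coord_field_expansion[OF X])
  qed (auto simp: coord_field_VF coord_field_add coord_field_scale dest: coord_field_inj)
qed

end

subsection \<open>Vector fields and tensors\<close>

lemma tscale_apply [simp]: "tscale c v f = c * v f"
  by (simp add: tscale_def)

lemma fscale_apply [simp]: "fscale f X p = tscale (f p) (X p)"
  by (simp add: fscale_def)

lemma lie_bracket_apply: "lie_bracket X Y p f = X p (\<lambda>q. Y q f) - Y p (\<lambda>q. X q f)"
  by (simp add: lie_bracket_def)

context smooth_manifold begin

lemma tangent_zero_closed [simp, intro]: "0 \<in> T p"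
  by (simp add: tangent_space_def)

lemma tangent_add_closed [simp, intro]: "u \<in> T p \<Longrightarrow> v \<in> T p \<Longrightarrow> u + v \<in> T p"
  by (simp add: tangent_space_def algebra_simps)

lemma tangent_uminus_closed [simp, intro]: "u \<in> T p \<Longrightarrow> - u \<in> T p"
  by (simp add: tangent_space_def algebra_simps)

lemma tangent_diff_closed [simp, intro]: "u \<in> T p \<Longrightarrow> v \<in> T p \<Longrightarrow> u - v \<in> T p"
  by (simp add: tangent_space_def algebra_simps)

lemma tangent_tscale_closed [simp, intro]: "u \<in> T p \<Longrightarrow> tscale c u \<in> T p"
  by (simp add: tangent_space_def algebra_simps)

lemma tangent_sum_closed [intro]: "(\<And>i. i \<in> I \<Longrightarrow> u i \<in> T p) \<Longrightarrow> (\<Sum>i\<in>I. u i) \<in> T p"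
  by (induction I rule: infinite_finite_induct) auto

lemma VF_I:
  "(\<And>p. X p \<in> T p) \<Longrightarrow> (\<And>f. f \<in> SF \<Longrightarrow> (\<lambda>p. X p f) \<in> SF) \<Longrightarrow> X \<in> VF"
  by (simp add: vfields_def)

lemma VF_tangent: "X \<in> VF \<Longrightarrow> X p \<in> T p"
  by (simp add: vfields_def)

lemma VF_smooth: "X \<in> VF \<Longrightarrow> f \<in> SF \<Longrightarrow> (\<lambda>p. X p f) \<in> SF"
  by (simp add: vfields_def)

declare VF_tangent [simp, intro] VF_smooth [simp, intro]

lemma VF_nonsmooth: "X \<in> VF \<Longrightarrow> f \<notin> SF \<Longrightarrow> X p f = 0"
  using tangent_nonsmooth VF_tangent by blast

lemma VF_const: "X \<in> VF \<Longrightarrow> X p (\<lambda>q. c) = 0"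
  using tangent_const VF_tangent by blast

lemma VF_der_add: "X \<in> VF \<Longrightarrow> f \<in> SF \<Longrightarrow> h \<in> SF \<Longrightarrow> X p (\<lambda>q. f q + h q) = X p f + X p h"
  using tangent_add VF_tangent by blast

lemma VF_der_diff: "X \<in> VF \<Longrightarrow> f \<in> SF \<Longrightarrow> h \<in> SF \<Longrightarrow> X p (\<lambda>q. f q - h q) = X p f - X p h"
  using tangent_diff VF_tangent by blast

lemma VF_der_scale: "X \<in> VF \<Longrightarrow> f \<in> SF \<Longrightarrow> X p (\<lambda>q. c * f q) = c * X p f"
  using tangent_scale VF_tangent by blast

lemma VF_der_mult:
  "X \<in> VF \<Longrightarrow> f \<in> SF \<Longrightarrow> h \<in> SF \<Longrightarrow> X p (\<lambda>q. f q * h q) = X p f * h p + f p * X p h"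
  using tangent_mult VF_tangent by blast

lemma VF_zero [simp, intro]: "0 \<in> VF"
  by (rule VF_I) simp_all

lemma VF_add [simp, intro]: "X \<in> VF \<Longrightarrow> Y \<in> VF \<Longrightarrow> X + Y \<in> VF"
  by (rule VF_I) simp_all

lemma VF_uminus [simp, intro]: "X \<in> VF \<Longrightarrow> - X \<in> VF"
  by (rule VF_I) simp_all

lemma VF_diff [simp, intro]: "X \<in> VF \<Longrightarrow> Y \<in> VF \<Longrightarrow> X - Y \<in> VF"
  by (rule VF_I) simp_all

lemma VF_fscale [simp, intro]: "f \<in> SF \<Longrightarrow> X \<in> VF \<Longrightarrow> fscale f X \<in> VF"
  by (rule VF_I) simp_all

lemma VF_sum [intro]: "(\<And>i. i \<in> I \<Longrightarrow> X i \<in> VF) \<Longrightarrow> (\<Sum>i\<in>I. X i) \<in> VF"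
  by (induction I rule: infinite_finite_induct) auto

lemma VF_lie_bracket [simp, intro]:
  assumes X: "X \<in> VF" and Y: "Y \<in> VF"
  shows "lie_bracket X Y \<in> VF"
proof -
  have "lie_bracket X Y p \<in> T p" for p
    unfolding tangent_space_def lie_bracket_def
    using X Y
    by (auto simp: VF_der_add[OF X] VF_der_add[OF Y] VF_der_mult[OF X] VF_der_mult[OF Y]
        VF_der_scale[OF X] VF_der_scale[OF Y] VF_const[OF X] VF_const[OF Y]
        VF_nonsmooth[OF X] VF_nonsmooth[OF Y] algebra_simps)
  then show ?thesis
    using X Y by (intro VF_I) (simp_all add: lie_bracket_apply)
qed

lemma lie_bracket_add_left:
  assumes "X \<in> VF" "X' \<in> VF" and Y: "Y \<in> VF"
  shows "lie_bracket (X + X') Y = lie_bracket X Y + lie_bracket X' Y"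
proof (intro ext)
  fix p f
  show "lie_bracket (X + X') Y p f = (lie_bracket X Y + lie_bracket X' Y) p f"
    using assms by (cases "f \<in> SF")
      (simp_all add: lie_bracket_apply VF_der_add[OF Y] assms[THEN VF_nonsmooth] VF_const[OF Y])
qed

lemma lie_bracket_swap: "lie_bracket X Y = - lie_bracket Y X"
  by (intro ext) (simp add: lie_bracket_apply)

lemma lie_bracket_add_right:
  assumes "X \<in> VF" "X' \<in> VF" "Y \<in> VF"
  shows "lie_bracket Y (X + X') = lie_bracket Y X + lie_bracket Y X'"
  using lie_bracket_add_left[OF assms]
  by (simp add: lie_bracket_swap[of Y])

lemma lie_bracket_uminus_left:
  assumes "X \<in> VF" "Y \<in> VF"
  shows "lie_bracket (- X) Y = - lie_bracket X Y"
  using lie_bracket_add_left[of X "- X" Y] lie_bracket_add_left[of 0 0 Y] assms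
  by (simp add: eq_neg_iff_add_eq_0)

lemma lie_bracket_fscale_right:
  assumes f: "f \<in> SF" and X: "X \<in> VF" and Y: "Y \<in> VF"
  shows "lie_bracket X (fscale f Y) = fscale (\<lambda>p. X p f) Y + fscale f (lie_bracket X Y)"
proof (intro ext)
  fix p h
  show "lie_bracket X (fscale f Y) p h =
      (fscale (\<lambda>p. X p f) Y + fscale f (lie_bracket X Y)) p h"
    using assms by (cases "h \<in> SF")
      (simp_all add: lie_bracket_apply VF_der_mult[OF X] VF_nonsmooth[OF X] VF_nonsmooth[OF Y]
        VF_const[OF X] algebra_simps)
qed

lemma lie_bracket_jacobi:
  assumes X: "X \<in> VF" and Y: "Y \<in> VF" and Z: "Z \<in> VF"
  shows "lie_bracket X (lie_bracket Y Z) + lie_bracket Y (lie_bracket Z X)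
    + lie_bracket Z (lie_bracket X Y) = 0"
proof (intro ext)
  fix p f
  show "(lie_bracket X (lie_bracket Y Z) + lie_bracket Y (lie_bracket Z X)
    + lie_bracket Z (lie_bracket X Y)) p f = 0 p f"
  proof (cases "f \<in> SF")
    case True
    with assms show ?thesis
      by (simp add: lie_bracket_apply VF_der_diff[OF X] VF_der_diff[OF Y] VF_der_diff[OF Z])
  next
    case False
    then have "lie_bracket V (lie_bracket V' V'') p f = 0" if "V \<in> VF" "V' \<in> VF" "V'' \<in> VF" for V V' V''
      using that by (intro VF_nonsmooth VF_lie_bracket)
    with assms show ?thesis by simp
  qed
qed

section \<open>Function-linear maps on vector fields\<close>

definition tensorial :: "('m vfield \<Rightarrow> 'm \<Rightarrow> real) \<Rightarrow> bool" where
  "tensorial \<Phi> \<longleftrightarrow> (\<forall>X\<in>VF. \<forall>Y\<in>VF. \<forall>p. \<Phi> (X + Y) p = \<Phi> X p + \<Phi> Y p) \<and>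
     (\<forall>f\<in>SF. \<forall>X\<in>VF. \<forall>p. \<Phi> (fscale f X) p = f p * \<Phi> X p)"

lemma tensorial_add: "tensorial \<Phi> \<Longrightarrow> X \<in> VF \<Longrightarrow> Y \<in> VF \<Longrightarrow> \<Phi> (X + Y) p = \<Phi> X p + \<Phi> Y p"
  by (simp add: tensorial_def)

lemma tensorial_fscale: "tensorial \<Phi> \<Longrightarrow> f \<in> SF \<Longrightarrow> X \<in> VF \<Longrightarrow> \<Phi> (fscale f X) p = f p * \<Phi> X p"
  by (simp add: tensorial_def)

lemma tensorial_zero: "tensorial \<Phi> \<Longrightarrow> \<Phi> 0 p = 0"
  using tensorial_add[of \<Phi> 0 0 p] by simp

lemma tensorial_sum:
  assumes "tensorial \<Phi>" "\<And>i. i \<in> I \<Longrightarrow> X i \<in> VF"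
  shows "\<Phi> (\<Sum>i\<in>I. X i) p = (\<Sum>i\<in>I. \<Phi> (X i) p)"
  using assms(2)
proof (induction I rule: infinite_finite_induct)
  case (insert i I)
  then have "(\<Sum>i\<in>I. X i) \<in> VF" by (intro VF_sum) simp
  then have "\<Phi> (X i + (\<Sum>i\<in>I. X i)) p = \<Phi> (X i) p + \<Phi> (\<Sum>i\<in>I. X i) p"
    using insert.prems by (intro tensorial_add[OF assms(1)]) simp_all
  with insert.IH insert.prems show ?case
    by (simp only: sum.insert[OF insert.hyps] insertI2)
qed (simp_all add: tensorial_zero[OF assms(1)])

text \<open>Multiplying \<open>X\<close> by a function that is 1 at \<open>p\<close> does not change
  the value there, and the product is a combination of coordinate fields with coefficients vanishing
  at \<open>p\<close>.\<close>

lemma tensorial_vanish: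
  assumes \<Phi>: "tensorial \<Phi>" and X: "X \<in> VF" "X p = 0"
  shows "\<Phi> X p = 0"
proof -
  obtain C :: "'e \<Rightarrow> 'm vfield" and h where C: "\<And>u. C u \<in> VF" and h: "h \<in> SF" "h p = 1"
    and ex: "\<And>X. X \<in> VF \<Longrightarrow> \<exists>a. (\<forall>b. a b \<in> SF \<and> (X p = 0 \<longrightarrow> a b p = 0)) \<and>
        fscale h X = (\<Sum>b\<in>Basis. fscale (a b) (C b))"
    by (rule obtain_coord_fields[of p]) blast
  from ex[OF X(1)] obtain a where a: "\<And>b. a b \<in> SF" "\<And>b. a b p = 0"
      "fscale h X = (\<Sum>b\<in>Basis. fscale (a b) (C b))"
    using X(2) by blast
  have "\<Phi> X p = \<Phi> (fscale h X) p"
    using tensorial_fscale[OF \<Phi> h(1) X(1)] h(2) by simp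
  also have "\<dots> = (\<Sum>b\<in>Basis. \<Phi> (fscale (a b) (C b)) p)"
    unfolding a(3) using a(1) C by (intro tensorial_sum[OF \<Phi>]) simp
  also have "\<dots> = 0"
    using a(1,2) C by (simp add: tensorial_fscale[OF \<Phi>])
  finally show ?thesis .
qed

text \<open>An expansion that holds at the single point \<open>p\<close> suffices: the difference of
  the two fields vanishes there.\<close>

lemma tensorial_expand:
  assumes \<Phi>: "tensorial \<Phi>" and X: "X \<in> VF" and Y: "\<And>i. i \<in> I \<Longrightarrow> Y i \<in> VF"
    and eq: "X p = (\<Sum>i\<in>I. tscale (c i) (Y i p))"
  shows "\<Phi> X p = (\<Sum>i\<in>I. c i * \<Phi> (Y i) p)"
proof -
  define S where "S = (\<Sum>i\<in>I. fscale (\<lambda>_. c i) (Y i))"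
  have S: "S \<in> VF" unfolding S_def using Y by (intro VF_sum) simp
  have "(X - S) p = 0"
    by (simp add: S_def sum_fun_apply eq)
  then have "\<Phi> (X - S) p = 0"
    using X S by (intro tensorial_vanish[OF \<Phi>]) simp_all
  moreover have "\<Phi> X p = \<Phi> (X - S) p + \<Phi> S p"
    using tensorial_add[OF \<Phi>, of "X - S" S p] X S by simp
  moreover have "\<Phi> S p = (\<Sum>i\<in>I. \<Phi> (fscale (\<lambda>_. c i) (Y i)) p)"
    unfolding S_def using Y by (intro tensorial_sum[OF \<Phi>]) simp
  moreover have "\<dots> = (\<Sum>i\<in>I. c i * \<Phi> (Y i) p)"
    using Y by (intro sum.cong) (simp_all add: tensorial_fscale[OF \<Phi>])
  ultimately show ?thesis by simp
qed

end

subsection \<open>Orthogonal frames and traces\<close>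

locale riemannian_manifold = smooth_manifold A
  for A :: "('m::{t2_space, second_countable_topology}, 'e::euclidean_space) atlas" +
  fixes g :: "'m metric"
  assumes metric: "riemannian_metric A g"
begin

section \<open>Pointwise algebra of the metric\<close>

lemma g_sym: "u \<in> T p \<Longrightarrow> v \<in> T p \<Longrightarrow> g p u v = g p v u"
  using metric unfolding riemannian_metric_def by blast

lemma g_add_left: "u \<in> T p \<Longrightarrow> v \<in> T p \<Longrightarrow> w \<in> T p \<Longrightarrow> g p (u + v) w = g p u w + g p v w"
  using metric unfolding riemannian_metric_def by blast

lemma g_scale_left: "u \<in> T p \<Longrightarrow> v \<in> T p \<Longrightarrow> g p (tscale c u) v = c * g p u v"
  using metric unfolding riemannian_metric_def by blast

lemma g_pos: "u \<in> T p \<Longrightarrow> u \<noteq> 0 \<Longrightarrow> g p u u > 0"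
  using metric unfolding riemannian_metric_def by blast

lemma g_add_right: "u \<in> T p \<Longrightarrow> v \<in> T p \<Longrightarrow> w \<in> T p \<Longrightarrow> g p w (u + v) = g p w u + g p w v"
  by (simp add: g_sym[of w] g_add_left)

lemma g_scale_right: "u \<in> T p \<Longrightarrow> v \<in> T p \<Longrightarrow> g p u (tscale c v) = c * g p u v"
  by (simp add: g_sym[of u] g_scale_left)

lemma g_zero_left [simp]: "v \<in> T p \<Longrightarrow> g p 0 v = 0"
  using g_add_left[of 0 p 0 v] by simp

lemma g_zero_right [simp]: "v \<in> T p \<Longrightarrow> g p v 0 = 0"
  using g_sym[of v p 0] by simp

lemma g_uminus_left: "u \<in> T p \<Longrightarrow> v \<in> T p \<Longrightarrow> g p (- u) v = - g p u v"
  using g_add_left[of u p "- u" v] by simp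

lemma g_uminus_right: "u \<in> T p \<Longrightarrow> v \<in> T p \<Longrightarrow> g p u (- v) = - g p u v"
  using g_add_right[of v p "- v" u] by simp

lemma g_sum_left:
  assumes "\<And>i. i \<in> I \<Longrightarrow> u i \<in> T p" "v \<in> T p"
  shows "g p (\<Sum>i\<in>I. u i) v = (\<Sum>i\<in>I. g p (u i) v)"
  using assms(1)
proof (induction I rule: infinite_finite_induct)
  case (insert i I)
  then have "(\<Sum>i\<in>I. u i) \<in> T p" by (intro tangent_sum_closed) simp
  then have "g p (u i + (\<Sum>i\<in>I. u i)) v = g p (u i) v + g p (\<Sum>i\<in>I. u i) v"
    using insert.prems assms(2) by (intro g_add_left) simp_all
  with insert.IH insert.prems show ?case
    by (simp only: sum.insert[OF insert.hyps] insertI2)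
qed (use assms(2) in simp_all)

lemma met_SF [simp, intro]: "X \<in> VF \<Longrightarrow> Y \<in> VF \<Longrightarrow> met g X Y \<in> SF"
  using metric unfolding riemannian_metric_def by blast

lemma met_sym: "X \<in> VF \<Longrightarrow> Y \<in> VF \<Longrightarrow> met g X Y = met g Y X"
  by (simp add: met_def fun_eq_iff g_sym)

lemma met_add_left:
  "X \<in> VF \<Longrightarrow> Y \<in> VF \<Longrightarrow> Z \<in> VF \<Longrightarrow> met g (X + Y) Z p = met g X Z p + met g Y Z p"
  by (simp add: met_def g_add_left)

lemma met_add_right:
  "X \<in> VF \<Longrightarrow> Y \<in> VF \<Longrightarrow> Z \<in> VF \<Longrightarrow> met g Z (X + Y) p = met g Z X p + met g Z Y p"
  by (simp add: met_def g_add_right)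

lemma met_uminus_left: "X \<in> VF \<Longrightarrow> Y \<in> VF \<Longrightarrow> met g (- X) Y p = - met g X Y p"
  by (simp add: met_def g_uminus_left)

lemma met_uminus_right: "X \<in> VF \<Longrightarrow> Y \<in> VF \<Longrightarrow> met g X (- Y) p = - met g X Y p"
  by (simp add: met_def g_uminus_right)

lemma met_diff_left:
  "X \<in> VF \<Longrightarrow> Y \<in> VF \<Longrightarrow> Z \<in> VF \<Longrightarrow> met g (X - Y) Z p = met g X Z p - met g Y Z p"
  using met_add_left[of X "- Y" Z p] by (simp add: met_uminus_left)

lemma met_diff_right:
  "X \<in> VF \<Longrightarrow> Y \<in> VF \<Longrightarrow> Z \<in> VF \<Longrightarrow> met g Z (X - Y) p = met g Z X p - met g Z Y p"
  using met_add_right[of X "- Y" Z p] by (simp add: met_uminus_right)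

lemma met_fscale_left:
  "X \<in> VF \<Longrightarrow> Y \<in> VF \<Longrightarrow> met g (fscale f X) Y p = f p * met g X Y p"
  by (simp add: met_def g_scale_left)

lemma met_sum_left:
  assumes "\<And>i. i \<in> I \<Longrightarrow> X i \<in> VF" "Y \<in> VF"
  shows "met g (\<Sum>i\<in>I. X i) Y p = (\<Sum>i\<in>I. met g (X i) Y p)"
proof -
  have "met g (\<Sum>i\<in>I. X i) Y p = g p (\<Sum>i\<in>I. X i p) (Y p)"
    unfolding met_def by (rule arg_cong[OF sum_fun_apply, where f = "\<lambda>u. g p u (Y p)"])
  also have "\<dots> = (\<Sum>i\<in>I. g p (X i p) (Y p))"
    using assms by (intro g_sum_left) auto
  finally show ?thesis by (simp only: met_def)
qed

lemma met_nondegenerate: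
  assumes "X \<in> VF" "\<And>Y. Y \<in> VF \<Longrightarrow> met g X Y p = 0"
  shows "X p = 0"
proof (rule ccontr)
  assume "X p \<noteq> 0"
  then have "met g X X p > 0" using g_pos[of "X p" p] assms(1) by (simp add: met_def)
  then show False using assms(2)[OF assms(1)] by simp
qed

text \<open>Tangent vectors form a function type with its own scaling \<open>tscale\<close>; through
  \<open>L\<close>, arguments about dimension, span and independence are carried out in the model
  space.\<close>

lemma obtain_tangent_iso:
  obtains L :: "'e \<Rightarrow> 'm tvec" and C :: "'e \<Rightarrow> 'm vfield" where
    "\<And>u. C u \<in> VF" "\<And>u. C u p = L u" "\<And>v. v \<in> T p \<Longrightarrow> \<exists>u. v = L u" "\<And>u. L u = 0 \<Longrightarrow> u = 0"
    "\<And>c u. L (c *\<^sub>R u) = tscale c (L u)" "\<And>u w. L (u - w) = L u - L w"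
    "\<And>I u. L (\<Sum>i\<in>(I::nat set). u i) = (\<Sum>i\<in>I. L (u i))"
proof -
  obtain C :: "'e \<Rightarrow> 'm vfield" where C: "\<And>u. C u \<in> VF" "\<And>u w. C (u + w) = C u + C w"
    "\<And>c u. C (c *\<^sub>R u) = fscale (\<lambda>_. c) (C u)"
    "\<And>v. v \<in> T p \<Longrightarrow> \<exists>u. v = C u p" "\<And>u. C u p = 0 \<Longrightarrow> u = 0"
    by (rule obtain_coord_fields[of p]) blast
  have add: "C (u + w) p = C u p + C w p" for u w
    by (simp add: C(2))
  have zero: "C 0 p = 0"
    using add[of 0 0] by simp
  have diff: "C (u - w) p = C u p - C w p" for u w
    using add[of "u - w" w] by simp
  have "C (\<Sum>i\<in>(I::nat set). u i) p = (\<Sum>i\<in>I. C (u i) p)" for I u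
    by (induction I rule: infinite_finite_induct) (simp_all add: add zero)
  then show ?thesis
    using C diff by (intro that[of C "\<lambda>u. C u p"]) simp_all
qed

text \<open>Nonzero orthogonal vectors are independent, and \<open>DIM('e)\<close> of them span.
  Unit length is not assumed, because the frames constructed below are normalized at one point
  only.\<close>

lemma orthogonal_expansion:
  assumes F: "\<And>i. i < DIM('e) \<Longrightarrow> F i \<in> VF"
    and orth: "\<And>i j. i < DIM('e) \<Longrightarrow> j < DIM('e) \<Longrightarrow> i \<noteq> j \<Longrightarrow> met g (F i) (F j) q = 0"
    and nz: "\<And>i. i < DIM('e) \<Longrightarrow> met g (F i) (F i) q \<noteq> 0"
    and v: "v \<in> T q"
  shows "v = (\<Sum>i<DIM('e). tscale (g q v (F i q) / met g (F i) (F i) q) (F i q))"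
proof -
  obtain L :: "'e \<Rightarrow> 'm tvec" where L: "\<And>v. v \<in> T q \<Longrightarrow> \<exists>u. v = L u" 
    "\<And>c u. L (c *\<^sub>R u) = tscale c (L u)" "\<And>u w. L (u - w) = L u - L w"
    "\<And>I u. L (\<Sum>i\<in>(I::nat set). u i) = (\<Sum>i\<in>I. L (u i))"
    by (rule obtain_tangent_iso[of q]) blast
  have "\<forall>i. \<exists>u. i < DIM('e) \<longrightarrow> F i q = L u"
    using L(1) F by blast
  then obtain u where u: "\<And>i. i < DIM('e) \<Longrightarrow> F i q = L (u i)"
    by metis
  \<comment> \<open>Pairing with \<open>F j\<close> isolates one coefficient. This serves twice: for
    independence and to identify the coefficients of \<open>v\<close>.\<close>
  have coeff: "g q (L (\<Sum>i<DIM('e). c i *\<^sub>R u i)) (F j q) = c j * met g (F j) (F j) q"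
    if j: "j < DIM('e)" for c j
  proof -
    have "L (\<Sum>i<DIM('e). c i *\<^sub>R u i) = (\<Sum>i<DIM('e). tscale (c i) (F i q))"
      by (simp add: L(2,4) u)
    then have "g q (L (\<Sum>i<DIM('e). c i *\<^sub>R u i)) (F j q) = (\<Sum>i<DIM('e). g q (tscale (c i) (F i q)) (F j q))"
      using F j by (simp only:) (intro g_sum_left, auto)
    also have "\<dots> = (\<Sum>i<DIM('e). if i = j then c j * met g (F j) (F j) q else 0)"
      using F j orth by (intro sum.cong) (auto simp: g_scale_left met_def)
    finally show ?thesis using j by simp
  qed
  have L0: "L 0 = 0"
    using L(3)[of 0 0] by simp
  have inj: "inj_on u {..<DIM('e)}"
  proof (rule inj_onI, rule ccontr)
    fix i j assume "i \<in> {..<DIM('e)}" "j \<in> {..<DIM('e)}" "u i = u j" "i \<noteq> j"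
    then show False
      using orth[of i j] nz[of i] u[of i] u[of j] by (simp add: met_def)
  qed
  have "independent (u ` {..<DIM('e)})"
  proof (rule independent_if_scalars_zero)
    fix f x assume 0: "(\<Sum>x\<in>u ` {..<DIM('e)}. f x *\<^sub>R x) = 0" and "x \<in> u ` {..<DIM('e)}"
    then obtain j where j: "j < DIM('e)" "x = u j" by blast
    have "(\<Sum>i<DIM('e). f (u i) *\<^sub>R u i) = 0"
      using 0 by (simp add: sum.reindex[OF inj])
    then have "f (u j) * met g (F j) (F j) q = 0"
      using coeff[OF j(1), of "\<lambda>i. f (u i)"] F j(1) by (simp add: L0)
    then show "f x = 0" using nz j by simp
  qed simp
  moreover have "card (u ` {..<DIM('e)}) = DIM('e)"
    by (simp add: card_image[OF inj])
  ultimately have "UNIV \<subseteq> span (u ` {..<DIM('e)})"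
    by (intro card_ge_dim_independent) simp_all
  moreover obtain w where w: "v = L w"
    using L(1)[OF v] by blast
  ultimately obtain f where "w = (\<Sum>x\<in>u ` {..<DIM('e)}. f x *\<^sub>R x)"
    by (auto simp: span_finite)
  then have w': "w = (\<Sum>i<DIM('e). f (u i) *\<^sub>R u i)"
    by (simp add: sum.reindex[OF inj])
  have "f (u j) = g q v (F j q) / met g (F j) (F j) q" if "j < DIM('e)" for j
    using coeff[OF that, of "\<lambda>i. f (u i)"] nz[OF that] by (simp add: w w')
  then show ?thesis
    by (simp add: w w' L(2,4) u)
qed

text \<open>Linear algebra at \<open>p\<close> gives a unit vector orthogonal to all
  \<open>F i p\<close>, but an extension \<open>U\<close> of it is orthogonal to them only at
  \<open>p\<close>. Subtracting projections repairs this elsewhere, and the corrections vanish at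
  \<open>p\<close>, so the value there is kept.\<close>

lemma orthogonal_fields_Suc:
  assumes k: "k < DIM('e)" and F: "\<And>i. i < k \<Longrightarrow> F i \<in> VF"
    and orth: "\<And>i j. i < k \<Longrightarrow> j < k \<Longrightarrow> i \<noteq> j \<Longrightarrow> met g (F i) (F j) = (\<lambda>_. 0)"
    and unit: "\<And>i. i < k \<Longrightarrow> met g (F i) (F i) p = 1"
  shows "\<exists>G\<in>VF. (\<forall>i<k. met g G (F i) = (\<lambda>_. 0)) \<and> met g G G p = 1"
proof -
  obtain L :: "'e \<Rightarrow> 'm tvec" and C :: "'e \<Rightarrow> 'm vfield" where
    L: "\<And>u. C u \<in> VF" "\<And>u. C u p = L u" "\<And>v. v \<in> T p \<Longrightarrow> \<exists>u. v = L u" "\<And>u. L u = 0 \<Longrightarrow> u = 0"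
    "\<And>c u. L (c *\<^sub>R u) = tscale c (L u)" "\<And>u w. L (u - w) = L u - L w"
    "\<And>I u. L (\<Sum>i\<in>(I::nat set). u i) = (\<Sum>i\<in>I. L (u i))"
    by (rule obtain_tangent_iso[of p]) blast
  have LT: "L u \<in> T p" for u
    using VF_tangent[OF L(1)[of u], of p] by (simp add: L(2))
  have "\<forall>i. \<exists>u. i < k \<longrightarrow> F i p = L u"
    using L(3) F by blast
  then obtain u where u: "\<And>i. i < k \<Longrightarrow> F i p = L (u i)"
    by metis
  have "dim (u ` {..<k}) < DIM('e)"
    using dim_le_card'[of "u ` {..<k}"] card_image_le[of "{..<k}" u] k by simp
  then have "span (u ` {..<k}) \<noteq> UNIV"
    by (metis dim_UNIV dim_span less_irrefl)
  then obtain w where w: "w \<notin> span (u ` {..<k})" by blast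
  define w' where "w' = w - (\<Sum>i<k. g p (L w) (F i p) *\<^sub>R u i)"
  have "w' \<noteq> 0"
  proof
    assume "w' = 0"
    then have "w = (\<Sum>i<k. g p (L w) (F i p) *\<^sub>R u i)" by (simp add: w'_def)
    also have "\<dots> \<in> span (u ` {..<k})"
      by (intro span_sum span_scale span_base) auto
    finally show False using w by simp
  qed
  then have pos: "g p (L w') (L w') > 0"
    using L(4) LT by (intro g_pos) auto
  have gw': "g p (L w') (F j p) = 0" if j: "j < k" for j
  proof -
    have "g p (\<Sum>i<k. tscale (g p (L w) (F i p)) (F i p)) (F j p)
        = (\<Sum>i<k. g p (tscale (g p (L w) (F i p)) (F i p)) (F j p))"
      using F j by (intro g_sum_left) auto
    also have "\<dots> = (\<Sum>i<k. if i = j then g p (L w) (F j p) else 0)"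
      using F j orth unit by (intro sum.cong) (auto simp: g_scale_left met_def fun_eq_iff)
    finally have "g p (\<Sum>i<k. tscale (g p (L w) (F i p)) (F i p)) (F j p) = g p (L w) (F j p)"
      using j by simp
    moreover have "L w = L w' + (\<Sum>i<k. tscale (g p (L w) (F i p)) (F i p))"
      by (simp add: w'_def L(5,6,7) u)
    moreover have "(\<Sum>i<k. tscale (g p (L w) (F i p)) (F i p)) \<in> T p"
      using F by (intro tangent_sum_closed) auto
    ultimately show ?thesis
      using g_add_left[of "L w'" p "\<Sum>i<k. tscale (g p (L w) (F i p)) (F i p)" "F j p"] LT F j
      by simp
  qed
  define U where "U = C (inverse (sqrt (g p (L w') (L w'))) *\<^sub>R w')"
  have U: "U \<in> VF" by (simp add: U_def L(1))
  have Up: "U p = tscale (inverse (sqrt (g p (L w') (L w')))) (L w')"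
    by (simp add: U_def L)
  have UF: "met g U (F j) p = 0" if "j < k" for j
    using gw'[OF that] F[OF that] LT by (simp add: met_def Up g_scale_left)
  have UU: "met g U U p = 1"
    using pos LT by (simp add: met_def Up g_scale_left g_scale_right field_simps)
  define N where "N j = met g (F j) (F j)" for j
  \<comment> \<open>The projection coefficient onto \<open>F j\<close> is
    \<open>met g U (F j) / N j\<close>; multiplied by the product of all \<open>N l\<close> it loses
    its denominator.\<close>
  define a where "a j = (\<lambda>q. (\<Prod>l\<in>{..<k} - {j}. N l q) * met g U (F j) q)" for j
  define P where "P = (\<lambda>q. \<Prod>l<k. N l q)"
  have N: "N j \<in> SF" if "j < k" for j using F that by (simp add: N_def)
  have a: "a j \<in> SF" if "j < k" for j
    unfolding a_def using F U N that by (intro SF_mult SF_prod) auto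
  have P: "P \<in> SF" unfolding P_def using N by (intro SF_prod) auto
  \<comment> \<open>Gram-Schmidt multiplied by the product of all \<open>N l\<close>, so that no smooth inverses are needed\<close>
  define G where "G = fscale P U - (\<Sum>j<k. fscale (a j) (F j))"
  have S: "(\<Sum>j<k. fscale (a j) (F j)) \<in> VF"
    using a F by (intro VF_sum) auto
  have G: "G \<in> VF" using P U S by (simp add: G_def)
  have "met g G (F i) q = 0" if i: "i < k" for i q
  proof -
    have "met g (\<Sum>j<k. fscale (a j) (F j)) (F i) q = (\<Sum>j<k. met g (fscale (a j) (F j)) (F i) q)"
      using a F i by (intro met_sum_left) auto
    also have "\<dots> = (\<Sum>j<k. if j = i then a i q * N i q else 0)"
      using F i orth by (intro sum.cong) (auto simp: met_fscale_left N_def)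
    also have "\<dots> = P q * met g U (F i) q"
      using i prod.remove[of "{..<k}" i "\<lambda>l. N l q"] by (simp add: a_def P_def mult_ac)
    finally show ?thesis
      using F i U P S by (simp add: G_def met_diff_left met_fscale_left)
  qed
  moreover have "G p = U p"
  proof -
    have "P p = 1" using unit by (simp add: P_def N_def)
    moreover have "a j p = 0" if "j < k" for j using UF[OF that] by (simp add: a_def)
    ultimately show ?thesis
      by (auto simp: G_def sum_fun_apply fun_eq_iff)
  qed
  then have "met g G G p = 1" using UU by (simp add: met_def)
  ultimately show ?thesis using G by (intro bexI[of _ G]) auto
qed

text \<open>Orthogonality is global, but fields may vanish away from \<open>p\<close>: nowhere
  vanishing global fields need not exist.\<close>

lemma exists_orthogonal_fields:
  "k \<le> DIM('e) \<Longrightarrow> \<exists>F. (\<forall>i<k. F i \<in> VF) \<and> (\<forall>i<k. \<forall>j<k. i \<noteq> j \<longrightarrow> met g (F i) (F j) = (\<lambda>_. 0))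
     \<and> (\<forall>i<k. met g (F i) (F i) p = 1)"
proof (induction k)
  case 0
  then show ?case by simp
next
  case (Suc k)
  then obtain F where F: "\<And>i. i < k \<Longrightarrow> F i \<in> VF"
    "\<And>i j. i < k \<Longrightarrow> j < k \<Longrightarrow> i \<noteq> j \<Longrightarrow> met g (F i) (F j) = (\<lambda>_. 0)"
    "\<And>i. i < k \<Longrightarrow> met g (F i) (F i) p = 1"
    by auto
  obtain G where G: "G \<in> VF" "\<And>i. i < k \<Longrightarrow> met g G (F i) = (\<lambda>_. 0)" "met g G G p = 1"
    using orthogonal_fields_Suc[of k F p] F Suc.prems by auto
  have "met g (F i) G = (\<lambda>_. 0)" if "i < k" for i
    using met_sym[of "F i" G] F(1) G(1,2) that by simp
  with F G show ?case
    by (intro exI[of _ "F(k := G)"]) (auto simp: less_Suc_eq)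
qed

lemma exists_orthonormal_frame_at: "\<exists>E. orthonormal_frame_at A g q E"
proof -
  from exists_orthogonal_fields[of "DIM('e)" q] obtain F where
    F: "\<And>i. i < DIM('e) \<Longrightarrow> F i \<in> VF"
      "\<And>i j. i < DIM('e) \<Longrightarrow> j < DIM('e) \<Longrightarrow> i \<noteq> j \<Longrightarrow> met g (F i) (F j) = (\<lambda>_. 0)"
      "\<And>i. i < DIM('e) \<Longrightarrow> met g (F i) (F i) q = 1"
    by auto
  then have "orthonormal_frame_at A g q F"
    by (auto simp: orthonormal_frame_at_def)
  then show ?thesis by blast
qed

text \<open>Expand both arguments in the \<open>F i\<close> and use Parseval for the coefficient
  matrix. This makes the trace independent of the frame chosen in \<open>ricci\<close> and evaluates
  it near a point by a frame that is unit only at that point.\<close>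

lemma trace_orthogonal:
  assumes B: "\<And>Y. Y \<in> VF \<Longrightarrow> tensorial (\<lambda>X. B X Y)" "\<And>X. X \<in> VF \<Longrightarrow> tensorial (\<lambda>Y. B X Y)"
    and E: "orthonormal_frame_at A g q E"
    and F: "\<And>i. i < DIM('e) \<Longrightarrow> F i \<in> VF"
    and orth: "\<And>i j. i < DIM('e) \<Longrightarrow> j < DIM('e) \<Longrightarrow> i \<noteq> j \<Longrightarrow> met g (F i) (F j) q = 0"
    and nz: "\<And>i. i < DIM('e) \<Longrightarrow> met g (F i) (F i) q \<noteq> 0"
  shows "(\<Sum>k<DIM('e). B (E k) (E k) q) = (\<Sum>i<DIM('e). B (F i) (F i) q / met g (F i) (F i) q)"
proof -
  have EV: "E k \<in> VF" if "k < DIM('e)" for k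
    using E that by (simp add: orthonormal_frame_at_def)
  have EE: "met g (E k) (E l) q = (if k = l then 1 else 0)" if "k < DIM('e)" "l < DIM('e)" for k l
    using E that by (simp add: orthonormal_frame_at_def)
  define N where "N i = met g (F i) (F i) q" for i
  define m where "m k i = met g (E k) (F i) q" for k i
  have BE: "B (E k) (E k) q = (\<Sum>i<DIM('e). \<Sum>j<DIM('e). (m k i / N i) * ((m k j / N j) * B (F i) (F j) q))"
    if k: "k < DIM('e)" for k
  proof -
    have Ek: "E k q = (\<Sum>i<DIM('e). tscale (m k i / N i) (F i q))"
      using orthogonal_expansion[of F q "E k q", OF F orth nz] EV[OF k] by (simp add: m_def N_def met_def)
    have "B (E k) (E k) q = (\<Sum>i<DIM('e). (m k i / N i) * B (F i) (E k) q)"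
      using B(1)[OF EV[OF k]] EV[OF k] F Ek
      by (intro tensorial_expand[where \<Phi> = "\<lambda>X. B X (E k)"]) simp_all
    also have "\<dots> = (\<Sum>i<DIM('e). (m k i / N i) * (\<Sum>j<DIM('e). (m k j / N j) * B (F i) (F j) q))"
    proof (intro sum.cong refl)
      fix i assume "i \<in> {..<DIM('e)}"
      then have "tensorial (\<lambda>Y. B (F i) Y)" using B(2) F by simp
      then have "B (F i) (E k) q = (\<Sum>j<DIM('e). (m k j / N j) * B (F i) (F j) q)"
        using EV[OF k] F Ek by (intro tensorial_expand[where \<Phi> = "\<lambda>Y. B (F i) Y"]) simp_all
      then show "(m k i / N i) * B (F i) (E k) q =
          (m k i / N i) * (\<Sum>j<DIM('e). (m k j / N j) * B (F i) (F j) q)" by simp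
    qed
    finally show ?thesis by (simp only: sum_distrib_left)
  qed
  \<comment> \<open>Parseval: expand \<open>F i\<close> in the orthonormal basis \<open>E k\<close>
    and pair with \<open>F j\<close>.\<close>
  have mm: "(\<Sum>k<DIM('e). m k i * m k j) = (if i = j then N i else 0)" if ij: "i < DIM('e)" "j < DIM('e)" for i j
  proof -
    have "F i q = (\<Sum>k<DIM('e). tscale (g q (F i q) (E k q) / met g (E k) (E k) q) (E k q))"
      by (rule orthogonal_expansion) (use EV EE F ij in auto)
    also have "\<dots> = (\<Sum>k<DIM('e). tscale (m k i) (E k q))"
      using EE EV F ij by (intro sum.cong) (auto simp: m_def met_def g_sym[of "F i q"])
    finally have "met g (F i) (F j) q = (\<Sum>k<DIM('e). g q (tscale (m k i) (E k q)) (F j q))"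
      using EV F ij by (simp only: met_def) (intro g_sum_left, auto)
    also have "\<dots> = (\<Sum>k<DIM('e). m k i * m k j)"
      using EV F ij by (intro sum.cong) (auto simp: g_scale_left m_def met_def)
    finally have "met g (F i) (F j) q = (\<Sum>k<DIM('e). m k i * m k j)" .
    then show ?thesis
      using orth[OF ij] by (cases "i = j") (simp_all add: N_def)
  qed
  have "(\<Sum>k<DIM('e). B (E k) (E k) q) =
      (\<Sum>k<DIM('e). \<Sum>i<DIM('e). \<Sum>j<DIM('e). m k i * m k j * (B (F i) (F j) q / (N i * N j)))"
    by (intro sum.cong refl) (simp add: BE mult_ac)
  also have "\<dots> = (\<Sum>i<DIM('e). \<Sum>k<DIM('e). \<Sum>j<DIM('e). m k i * m k j * (B (F i) (F j) q / (N i * N j)))"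
    by (rule sum.swap)
  also have "\<dots> = (\<Sum>i<DIM('e). \<Sum>j<DIM('e). \<Sum>k<DIM('e). m k i * m k j * (B (F i) (F j) q / (N i * N j)))"
    by (intro sum.cong refl sum.swap)
  also have "\<dots> = (\<Sum>i<DIM('e). \<Sum>j<DIM('e). (if i = j then N i else 0) * (B (F i) (F j) q / (N i * N j)))"
    by (intro sum.cong refl) (simp only: mm lessThan_iff sum_distrib_right[symmetric])
  also have "\<dots> = (\<Sum>i<DIM('e). B (F i) (F i) q / N i)"
  proof (intro sum.cong refl)
    fix i assume i: "i \<in> {..<DIM('e)}"
    have "(\<Sum>j<DIM('e). (if i = j then N i else 0) * (B (F i) (F j) q / (N i * N j))) =
        (\<Sum>j<DIM('e). if j = i then B (F i) (F i) q / N i else 0)"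
      using nz by (intro sum.cong refl) (auto simp: N_def)
    then show "(\<Sum>j<DIM('e). (if i = j then N i else 0) * (B (F i) (F j) q / (N i * N j))) =
        B (F i) (F i) q / N i"
      using i by simp
  qed
  finally show ?thesis by (simp add: N_def)
qed

text \<open>Near \<open>p\<close> the trace is the sum of the quotients
  \<open>B (F i) (F i) / met g (F i) (F i)\<close>; the formula is the quotient rule with all
  denominators equal to 1 at \<open>p\<close>. The proof clears denominators by their product
  \<open>P\<close>.\<close>

lemma trace_derivative:
  assumes B: "\<And>Y. Y \<in> VF \<Longrightarrow> tensorial (\<lambda>X. B X Y)" "\<And>X. X \<in> VF \<Longrightarrow> tensorial (\<lambda>Y. B X Y)"
    and B_SF: "\<And>X Y. X \<in> VF \<Longrightarrow> Y \<in> VF \<Longrightarrow> B X Y \<in> SF"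
    and \<tau>: "\<tau> \<in> SF" "\<And>q E. orthonormal_frame_at A g q E \<Longrightarrow> \<tau> q = (\<Sum>k<DIM('e). B (E k) (E k) q)"
    and F: "\<And>i. i < DIM('e) \<Longrightarrow> F i \<in> VF"
    and orth: "\<And>i j. i < DIM('e) \<Longrightarrow> j < DIM('e) \<Longrightarrow> i \<noteq> j \<Longrightarrow> met g (F i) (F j) = (\<lambda>_. 0)"
    and unit: "\<And>i. i < DIM('e) \<Longrightarrow> met g (F i) (F i) p = 1"
    and v: "v \<in> T p"
  shows "v \<tau> = (\<Sum>i<DIM('e). v (B (F i) (F i)) - v (met g (F i) (F i)) * B (F i) (F i) p)"
proof -
  define N where "N i = met g (F i) (F i)" for i
  define b where "b i = B (F i) (F i)" for i
  have N: "N i \<in> SF" "N i p = 1" if "i < DIM('e)" for i using F unit that by (simp_all add: N_def)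
  have b: "b i \<in> SF" if "i < DIM('e)" for i using F B_SF that by (simp add: b_def)
  define P where "P = (\<lambda>q. \<Prod>i<DIM('e). N i q)"
  define Q where "Q i = (\<lambda>q. \<Prod>j\<in>{..<DIM('e)} - {i}. N j q)" for i
  have P: "P \<in> SF" unfolding P_def using N by (intro SF_prod) auto
  have Q: "Q i \<in> SF" for i unfolding Q_def using N by (intro SF_prod) auto
  have Pp: "P p = 1" and Qp: "Q i p = 1" for i using N by (auto simp: P_def Q_def intro!: prod.neutral)
  have PQ: "P q = N i q * Q i q" if "i < DIM('e)" for i q
    using prod.remove[of "{..<DIM('e)}" i "\<lambda>i. N i q"] that by (simp add: P_def Q_def)
  have vP: "v P = (\<Sum>i<DIM('e). v (N i))"
    unfolding P_def using N by (intro tangent_prod_unit[OF v]) auto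
  define f where "f = (\<lambda>q. P q * \<tau> q - (\<Sum>i<DIM('e). Q i q * b i q))"
  have S: "(\<lambda>q. \<Sum>i<DIM('e). Q i q * b i q) \<in> SF"
    using Q b by (intro SF_sum) auto
  have f: "f \<in> SF" unfolding f_def using P \<tau>(1) S by (intro SF_diff SF_mult)
  \<comment> \<open>\<open>f\<close> vanishes near \<open>p\<close>; since \<open>P * f = 0\<close> and \<open>P p = 1\<close>, the derivation \<open>v\<close> kills it\<close>
  have f0: "f q = 0" if "P q \<noteq> 0" for q
  proof -
    have nz: "N i q \<noteq> 0" if "i < DIM('e)" for i using PQ[OF that, of q] \<open>P q \<noteq> 0\<close> by auto
    obtain E where E: "orthonormal_frame_at A g q E"
      using exists_orthonormal_frame_at by blast
    have "\<tau> q = (\<Sum>i<DIM('e). b i q / N i q)"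
      unfolding b_def N_def \<tau>(2)[OF E]
      by (rule trace_orthogonal[OF B E]) (use F orth nz in \<open>auto simp: N_def\<close>)
    then have "P q * \<tau> q = (\<Sum>i<DIM('e). P q * (b i q / N i q))"
      by (simp add: sum_distrib_left)
    also have "\<dots> = (\<Sum>i<DIM('e). Q i q * b i q)"
      by (intro sum.cong refl) (use PQ nz in auto)
    finally show ?thesis by (simp add: f_def)
  qed
  then have "P q * f q = 0" for q
    by (cases "P q = 0") simp_all
  then have "v (\<lambda>q. P q * f q) = 0" by (simp only: tangent_const[OF v])
  then have "v f = 0"
    using f0[of p] by (simp add: tangent_mult[OF v] P f Pp)
  moreover have "v (\<lambda>q. \<Sum>i<DIM('e). Q i q * b i q) = (\<Sum>i<DIM('e). v (\<lambda>q. Q i q * b i q))"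
    using Q b by (intro tangent_sum[OF v]) auto
  then have "v (\<lambda>q. \<Sum>i<DIM('e). Q i q * b i q) = (\<Sum>i<DIM('e). v (Q i) * b i p + v (b i))"
    using Q b by (simp add: tangent_mult[OF v] Qp)
  then have "v f = v P * \<tau> p + v \<tau> - (\<Sum>i<DIM('e). v (Q i) * b i p + v (b i))"
    unfolding f_def using P \<tau>(1) S Q b
    by (simp add: tangent_diff[OF v] tangent_mult[OF v] Pp)
  \<comment> \<open>The parts with \<open>v P\<close> add up to \<open>v P * \<tau> p\<close> and
    cancel, leaving the correction by \<open>v (N i)\<close>.\<close>
  moreover have "v (Q i) = v P - v (N i)" if "i < DIM('e)" for i
  proof -
    have "v (Q i) = (\<Sum>j\<in>{..<DIM('e)} - {i}. v (N j))"
      unfolding Q_def using N by (intro tangent_prod_unit[OF v]) auto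
    then show ?thesis
      using that sum.remove[of "{..<DIM('e)}" i "\<lambda>i. v (N i)"] by (simp add: vP)
  qed
  moreover have "\<tau> p = (\<Sum>i<DIM('e). b i p)"
    unfolding b_def by (rule \<tau>(2)) (use F orth unit in \<open>auto simp: orthonormal_frame_at_def\<close>)
  ultimately show ?thesis
    by (simp add: b_def N_def sum_subtractf sum.distrib sum_distrib_left algebra_simps)
qed

end

subsection \<open>Torsion and curvature of the real Chern connection\<close>

locale chern_manifold = riemannian_manifold A g
  for A :: "('m::{t2_space, second_countable_topology}, 'e::euclidean_space) atlas"
    and g :: "'m metric" +
  fixes J :: "'m endo" and D :: "'m connection"
  assumes hermitian: "hermitian_manifold A g J"
    and chern: "real_chern_connection A g J D"
begin

abbreviation "j \<equiv> app J"
abbreviation "br \<equiv> lie_bracket"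

lemma complex_structure: "integrable_complex_structure A J"
  using hermitian by (simp add: hermitian_manifold_def)

lemma affine: "affine_connection A D"
  using chern by (simp add: real_chern_connection_def)

lemma j_VF [simp]: "X \<in> VF \<Longrightarrow> j X \<in> VF"
  using complex_structure unfolding integrable_complex_structure_def by blast

lemma j_j [simp]: "X \<in> VF \<Longrightarrow> j (j X) = - X"
  using complex_structure unfolding integrable_complex_structure_def
  by (intro ext) (simp add: app_def)

lemma j_add: "X \<in> VF \<Longrightarrow> Y \<in> VF \<Longrightarrow> j (X + Y) = j X + j Y"
proof
  fix p assume "X \<in> VF" "Y \<in> VF"
  then have "X p \<in> T p" "Y p \<in> T p" by simp_all
  then have "J p (X p + Y p) = J p (X p) + J p (Y p)"
    using complex_structure unfolding integrable_complex_structure_def by blast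
  then show "j (X + Y) p = (j X + j Y) p" by (simp add: app_def)
qed

lemma j_zero [simp]: "j 0 = 0"
  using j_add[of 0 0] by simp

lemma j_uminus: "X \<in> VF \<Longrightarrow> j (- X) = - j X"
  using j_add[of X "- X"] by (simp add: eq_neg_iff_add_eq_0 add.commute)

lemma j_diff: "X \<in> VF \<Longrightarrow> Y \<in> VF \<Longrightarrow> j (X - Y) = j X - j Y"
  using j_add[of X "- Y"] by (simp add: j_uminus)

lemma met_j_j: "X \<in> VF \<Longrightarrow> Y \<in> VF \<Longrightarrow> met g (j X) (j Y) p = met g X Y p"
  using hermitian by (simp add: hermitian_manifold_def met_def app_def)

lemma met_j_left: "X \<in> VF \<Longrightarrow> Y \<in> VF \<Longrightarrow> met g (j X) Y p = - met g X (j Y) p"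
  using met_j_j[of X "j Y" p] by (simp add: met_uminus_right)

lemma D_VF [simp]: "X \<in> VF \<Longrightarrow> Y \<in> VF \<Longrightarrow> D X Y \<in> VF"
  using affine by (simp add: affine_connection_def)

lemma D_add_left: "X \<in> VF \<Longrightarrow> Y \<in> VF \<Longrightarrow> Z \<in> VF \<Longrightarrow> D (X + Y) Z = D X Z + D Y Z"
  using affine by (simp add: affine_connection_def)

lemma D_add_right: "X \<in> VF \<Longrightarrow> Y \<in> VF \<Longrightarrow> Z \<in> VF \<Longrightarrow> D X (Y + Z) = D X Y + D X Z"
  using affine by (simp add: affine_connection_def)

lemma D_fscale_left: "f \<in> SF \<Longrightarrow> X \<in> VF \<Longrightarrow> Y \<in> VF \<Longrightarrow> D (fscale f X) Y = fscale f (D X Y)"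
  using affine by (simp add: affine_connection_def)

lemma D_fscale_right: "f \<in> SF \<Longrightarrow> X \<in> VF \<Longrightarrow> Y \<in> VF \<Longrightarrow>
    D X (fscale f Y) = fscale (\<lambda>p. X p f) Y + fscale f (D X Y)"
  using affine by (simp add: affine_connection_def)

lemma D_zero_left [simp]: "X \<in> VF \<Longrightarrow> D 0 X = 0"
  using D_add_left[of 0 0 X] by simp

lemma D_zero_right [simp]: "X \<in> VF \<Longrightarrow> D X 0 = 0"
  using D_add_right[of X 0 0] by simp

lemma D_uminus_left: "X \<in> VF \<Longrightarrow> Y \<in> VF \<Longrightarrow> D (- X) Y = - D X Y"
  using D_add_left[of X "- X" Y] by (simp add: eq_neg_iff_add_eq_0 add.commute)

lemma D_uminus_right: "X \<in> VF \<Longrightarrow> Y \<in> VF \<Longrightarrow> D X (- Y) = - D X Y"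
  using D_add_right[of X Y "- Y"] by (simp add: eq_neg_iff_add_eq_0 add.commute)

lemma D_diff_left: "X \<in> VF \<Longrightarrow> Y \<in> VF \<Longrightarrow> Z \<in> VF \<Longrightarrow> D (X - Y) Z = D X Z - D Y Z"
  using D_add_left[of X "- Y" Z] by (simp add: D_uminus_left)

lemma D_diff_right: "X \<in> VF \<Longrightarrow> Y \<in> VF \<Longrightarrow> Z \<in> VF \<Longrightarrow> D X (Y - Z) = D X Y - D X Z"
  using D_add_right[of X Y "- Z"] by (simp add: D_uminus_right)

lemma br_zero [simp]: "X \<in> VF \<Longrightarrow> br 0 X = 0" "X \<in> VF \<Longrightarrow> br X 0 = 0"
  using lie_bracket_add_left[of 0 0 X] lie_bracket_add_right[of 0 0 X] by simp_all

lemma br_uminus_right: "X \<in> VF \<Longrightarrow> Y \<in> VF \<Longrightarrow> br X (- Y) = - br X Y"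
  using lie_bracket_add_right[of Y "- Y" X] by (simp add: eq_neg_iff_add_eq_0 add.commute)

lemma br_diff_left: "X \<in> VF \<Longrightarrow> Y \<in> VF \<Longrightarrow> Z \<in> VF \<Longrightarrow> br (X - Y) Z = br X Z - br Y Z"
  using lie_bracket_add_left[of X "- Y" Z] by (simp add: lie_bracket_uminus_left)

lemma br_diff_right: "X \<in> VF \<Longrightarrow> Y \<in> VF \<Longrightarrow> Z \<in> VF \<Longrightarrow> br Z (X - Y) = br Z X - br Z Y"
  using lie_bracket_add_right[of X "- Y" Z] by (simp add: br_uminus_right)

lemmas linear_simps = j_add j_uminus j_diff D_add_left D_add_right D_uminus_left D_uminus_right
  D_diff_left D_diff_right lie_bracket_add_left lie_bracket_add_right lie_bracket_uminus_left
  br_uminus_right br_diff_left br_diff_right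

lemma D_met:
  "X \<in> VF \<Longrightarrow> Y \<in> VF \<Longrightarrow> Z \<in> VF \<Longrightarrow> X p (met g Y Z) = met g (D X Y) Z p + met g Y (D X Z) p"
  using chern by (simp add: real_chern_connection_def preserves_metric_def)

lemma D_j: "X \<in> VF \<Longrightarrow> Y \<in> VF \<Longrightarrow> D X (j Y) = j (D X Y)"
  using chern by (simp add: real_chern_connection_def preserves_endo_def)

lemma re_im_cvf [simp]: "re_vf (cvf X Y) = X" "im_vf (cvf X Y) = Y"
  by (simp_all add: re_vf_def im_vf_def cvf_def)

lemma re_proj10: "re_vf (proj10 J U) p f = (1 / 2) * (re_vf U + j (im_vf U)) p f"
proof -
  have "capp J U p f = Complex (j (re_vf U) p f) (j (im_vf U) p f)"
    by (simp add: capp_def cvf_def)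
  moreover have "Re (proj10 J U p f) = (1 / 2) * (Re (U p f) + Im (capp J U p f))"
    by (simp add: proj10_def cscale_def)
  moreover have "re_vf (proj10 J U) p f = Re (proj10 J U p f)" "re_vf U p f = Re (U p f)"
    by (simp_all add: re_vf_def)
  ultimately show ?thesis by simp
qed

text \<open>The real part of the condition that the (0,1)-part of the connection is
  \<open>dbar\<close>. Vanishing of the Nijenhuis tensor rewrites the bracket of \<open>j X\<close>
  and \<open>j Y\<close>, so that the terms double against the factor 1/2 of the projection.\<close>

lemma chern_dbar:
  assumes X: "X \<in> VF" and Y: "Y \<in> VF"
  shows "D X Y + j (D (j X) Y) = br X Y + j (br (j X) Y)"
proof -
  \<comment> \<open>\<open>V = X + \<i> J X\<close> has type \<open>(0,1)\<close> and \<open>W = Y - \<i> J Y\<close> has type \<open>(1,0)\<close>\<close>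
  define V where "V = cvf X (j X)"
  define W where "W = cvf Y (- j Y)"
  have "capp J V = cvf (j X) (- X)" "capp J W = cvf (j Y) Y"
    using X Y by (simp_all add: capp_def V_def W_def j_uminus)
  moreover have "cvf (j X) (- X) = cscale (\<lambda>_. - \<i>) V" "cvf (j Y) Y = cscale (\<lambda>_. \<i>) W"
    by (simp_all add: V_def W_def cvf_def cscale_def fun_eq_iff complex_eq_iff)
  moreover have "V \<in> cvfields A" "W \<in> cvfields A"
    using X Y by (simp_all add: cvfields_def V_def W_def)
  ultimately have "V \<in> T01 A J" "W \<in> T10 A J"
    by (simp_all add: T01_def T10_def)
  moreover have "chern_connection_T10 A g J (complexify D)"
    using chern by (simp add: real_chern_connection_def)
  ultimately have "complexify D V W = dbar J V W"
    by (simp add: chern_connection_T10_def)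
  then have eq: "re_vf (complexify D V W) = re_vf (dbar J V W)" by simp
  have lhs: "re_vf (complexify D V W) = D X Y + j (D (j X) Y)"
    using X Y by (simp add: complexify_def V_def W_def linear_simps D_j)
  have "nijenhuis J X Y = 0"
    using complex_structure X Y by (simp add: integrable_complex_structure_def)
  then have N: "br (j X) (j Y) = j (br (j X) Y) + j (br X (j Y)) + br X Y"
    by (simp add: nijenhuis_def diff_eq_eq)
  have "re_vf (complexify br V W) = br X Y + br (j X) (j Y)"
    "im_vf (complexify br V W) = br (j X) Y - br X (j Y)"
    using X Y by (simp_all add: complexify_def V_def W_def linear_simps)
  then have "re_vf (dbar J V W) p f = (1 / 2) * (br X Y + br (j X) (j Y) + j (br (j X) Y - br X (j Y))) p f" for p f
    by (simp only: dbar_def re_proj10)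
  also have "(1 / 2) * (br X Y + br (j X) (j Y) + j (br (j X) Y - br X (j Y))) p f
      = (br X Y + j (br (j X) Y)) p f" for p f
    using X Y unfolding N by (simp add: linear_simps)
  finally have "re_vf (dbar J V W) = br X Y + j (br (j X) Y)"
    by (intro ext)
  with eq lhs show ?thesis by simp
qed

section \<open>Torsion, curvature and their covariant derivatives\<close>

definition Tor :: "'m vfield \<Rightarrow> 'm vfield \<Rightarrow> 'm vfield" where
  "Tor X Y = D X Y - D Y X - br X Y"

definition Rm :: "'m vfield \<Rightarrow> 'm vfield \<Rightarrow> 'm vfield \<Rightarrow> 'm vfield" where
  "Rm X Y Z = D X (D Y Z) - D Y (D X Z) - D (br X Y) Z"

text \<open>\<open>NTor\<close> and \<open>NRm\<close> are the covariant derivatives of torsion and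
  curvature; the first argument is the direction of differentiation.\<close>

definition NTor :: "'m vfield \<Rightarrow> 'm vfield \<Rightarrow> 'm vfield \<Rightarrow> 'm vfield" where
  "NTor X Y Z = D X (Tor Y Z) - Tor (D X Y) Z - Tor Y (D X Z)"

definition NRm :: "'m vfield \<Rightarrow> 'm vfield \<Rightarrow> 'm vfield \<Rightarrow> 'm vfield \<Rightarrow> 'm vfield" where
  "NRm X Y Z W = D X (Rm Y Z W) - Rm (D X Y) Z W - Rm Y (D X Z) W - Rm Y Z (D X W)"

lemma Tor_VF [simp]: "X \<in> VF \<Longrightarrow> Y \<in> VF \<Longrightarrow> Tor X Y \<in> VF"
  by (simp add: Tor_def)

lemma Rm_VF [simp]: "X \<in> VF \<Longrightarrow> Y \<in> VF \<Longrightarrow> Z \<in> VF \<Longrightarrow> Rm X Y Z \<in> VF"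
  by (simp add: Rm_def)

lemma NRm_VF [simp]: "X \<in> VF \<Longrightarrow> Y \<in> VF \<Longrightarrow> Z \<in> VF \<Longrightarrow> W \<in> VF \<Longrightarrow> NRm X Y Z W \<in> VF"
  by (simp add: NRm_def)

lemma curvature_eq_Rm: "curvature g D X Y Z W = met g (Rm X Y Z) W"
  by (simp add: curvature_def Rm_def)

lemma Tor_swap: "X \<in> VF \<Longrightarrow> Y \<in> VF \<Longrightarrow> Tor Y X = - Tor X Y"
  using lie_bracket_swap[of X Y] by (simp add: Tor_def algebra_simps)

text \<open>Apply \<open>j\<close> to \<open>chern_dbar\<close>; the remaining term of the torsion
  commutes with \<open>j\<close> by \<open>D_j\<close>. In complex terms the torsion vanishes on
  mixed types and preserves the type of equal ones.\<close>

lemma Tor_j_left: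
  assumes X: "X \<in> VF" and Y: "Y \<in> VF"
  shows "Tor (j X) Y = j (Tor X Y)"
proof -
  have "j (D X Y + j (D (j X) Y)) = j (br X Y + j (br (j X) Y))"
    using chern_dbar[OF X Y] by simp
  then have "j (D X Y) - D (j X) Y = j (br X Y) - br (j X) Y"
    using X Y by (simp add: linear_simps)
  then show ?thesis
    using X Y by (simp add: Tor_def linear_simps D_j algebra_simps)
qed

lemma Tor_j_right: "X \<in> VF \<Longrightarrow> Y \<in> VF \<Longrightarrow> Tor X (j Y) = j (Tor X Y)"
  using Tor_j_left[of Y X] Tor_swap[of "j Y" X] Tor_swap[of Y X] by (simp add: j_uminus)

lemma Tor_uminus: "X \<in> VF \<Longrightarrow> Y \<in> VF \<Longrightarrow> Tor (- X) Y = - Tor X Y"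
  "X \<in> VF \<Longrightarrow> Y \<in> VF \<Longrightarrow> Tor X (- Y) = - Tor X Y"
  by (simp_all add: Tor_def linear_simps)

text \<open>The first Bianchi identity in the presence of torsion. After unfolding, second
  derivatives cancel in pairs and iterated brackets cancel by the Jacobi identity.\<close>

lemma bianchi1:
  assumes X: "X \<in> VF" and Y: "Y \<in> VF" and Z: "Z \<in> VF"
  shows "Rm X Y Z + Rm Y Z X + Rm Z X Y =
    NTor X Y Z + NTor Y Z X + NTor Z X Y +
    (Tor (Tor X Y) Z + Tor (Tor Y Z) X + Tor (Tor Z X) Y)"
proof -
  \<comment> \<open>One orientation is fixed for each bracket that occurs in both orders, so that
    cancellation becomes syntactic.\<close>
  have sw: "br Y (D X Z) = - br (D X Z) Y" "br Z (D Y X) = - br (D Y X) Z"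
    "br X (D Z Y) = - br (D Z Y) X"
    "br (br X Y) Z = - br Z (br X Y)" "br (br Y Z) X = - br X (br Y Z)"
    "br (br Z X) Y = - br Y (br Z X)"
    by (rule lie_bracket_swap)+
  have jac: "br X (br Y Z) = - br Y (br Z X) - br Z (br X Y)"
    using lie_bracket_jacobi[OF X Y Z] by (simp add: algebra_simps eq_neg_iff_add_eq_0)
  show ?thesis
    using X Y Z by (simp add: Rm_def NTor_def Tor_def linear_simps sw jac algebra_simps)
qed

lemma bianchi2:
  assumes X: "X \<in> VF" and Y: "Y \<in> VF" and Z: "Z \<in> VF" and W: "W \<in> VF"
  shows "NRm X Y Z W + NRm Y Z X W + NRm Z X Y W +
    (Rm (Tor X Y) Z W + Rm (Tor Y Z) X W + Rm (Tor Z X) Y W) = 0"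
proof -
  have sw: "br Y (D X Z) = - br (D X Z) Y" "br Z (D Y X) = - br (D Y X) Z"
    "br X (D Z Y) = - br (D Z Y) X"
    "br (br X Y) Z = - br Z (br X Y)" "br (br Y Z) X = - br X (br Y Z)"
    "br (br Z X) Y = - br Y (br Z X)"
    by (rule lie_bracket_swap)+
  have jac: "br X (br Y Z) = - br Y (br Z X) - br Z (br X Y)"
    using lie_bracket_jacobi[OF X Y Z] by (simp add: algebra_simps eq_neg_iff_add_eq_0)
  show ?thesis
    using X Y Z W by (simp add: NRm_def Rm_def Tor_def linear_simps sw jac algebra_simps)
qed

lemma Rm_swap: "X \<in> VF \<Longrightarrow> Y \<in> VF \<Longrightarrow> Z \<in> VF \<Longrightarrow> Rm Y X Z = - Rm X Y Z"
  using lie_bracket_swap[of X Y] by (simp add: Rm_def linear_simps)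

lemma Rm_j: "X \<in> VF \<Longrightarrow> Y \<in> VF \<Longrightarrow> Z \<in> VF \<Longrightarrow> Rm X Y (j Z) = j (Rm X Y Z)"
  by (simp add: Rm_def linear_simps D_j)

lemma Rm_uminus: "X \<in> VF \<Longrightarrow> Y \<in> VF \<Longrightarrow> Z \<in> VF \<Longrightarrow> Rm (- X) Y Z = - Rm X Y Z"
  "X \<in> VF \<Longrightarrow> Y \<in> VF \<Longrightarrow> Z \<in> VF \<Longrightarrow> Rm X (- Y) Z = - Rm X Y Z"
  "X \<in> VF \<Longrightarrow> Y \<in> VF \<Longrightarrow> Z \<in> VF \<Longrightarrow> Rm X Y (- Z) = - Rm X Y Z"
  by (simp_all add: Rm_def linear_simps)

end

section \<open>Invariance of the curvature under the complex structure\<close>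

context chern_manifold begin

text \<open>Since the connection preserves \<open>J\<close>, complex linearity of the torsion passes
  to its covariant derivative, in the two torsion arguments.\<close>

lemma NTor_j:
  assumes "X \<in> VF" "Y \<in> VF" "Z \<in> VF"
  shows "NTor X (j Y) Z = j (NTor X Y Z)" "NTor X Y (j Z) = j (NTor X Y Z)"
  using assms by (simp_all add: NTor_def Tor_j_left Tor_j_right linear_simps D_j)

lemma NTor_VF [simp]: "X \<in> VF \<Longrightarrow> Y \<in> VF \<Longrightarrow> Z \<in> VF \<Longrightarrow> NTor X Y Z \<in> VF"
  by (simp add: NTor_def)

text \<open>This is the \<open>(1,0)\<close>-part of the first Bianchi identity for two vectors of type \<open>(0,1)\<close> and one
  of type \<open>(1,0)\<close>, written with real vector fields.\<close>

lemma Rm_j_j_aux: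
  assumes X: "X \<in> VF" and Y: "Y \<in> VF" and Z: "Z \<in> VF"
  shows "Rm X Y Z - Rm (j X) (j Y) Z = - j (Rm (j X) Y Z + Rm X (j Y) Z)"
proof -
  define b where "b X Y Z = Rm X Y Z + Rm Y Z X + Rm Z X Y" for X Y Z
  \<comment> \<open>Extend \<open>b\<close> complex linearly and evaluate it at
    \<open>X + \<i> j X\<close>, \<open>Y + \<i> j Y\<close>, \<open>Z - \<i> j Z\<close>: the first
    four terms are the real part, those under the outer \<open>j\<close> the imaginary part. Real
    part plus \<open>j\<close> of the imaginary part is twice the real part of the
    (1,0)-projection.\<close>
  define B where "B = b X Y Z - b (j X) (j Y) Z + b (j X) Y (j Z) + b X (j Y) (j Z)
    + j (b (j X) Y Z + b X (j Y) Z - b X Y (j Z) + b (j X) (j Y) (j Z))"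
  define P where "P = Rm X Y Z - Rm (j X) (j Y) Z + j (Rm (j X) Y Z + Rm X (j Y) Z)"
  \<comment> \<open>Curvature endomorphisms preserve type, so the projection kills the two cyclic
    terms acting on (0,1)-vectors and keeps the one acting on the (1,0)-vector.\<close>
  have BP: "B = P + P"
    using X Y Z unfolding B_def P_def b_def
    by (simp only: linear_simps Rm_VF j_VF VF_add VF_diff)
      (simp only: Rm_j Rm_VF j_VF j_j Rm_uminus, simp add: algebra_simps)
  have b: "b U V W = NTor U V W + NTor V W U + NTor W U V +
      (Tor (Tor U V) W + Tor (Tor V W) U + Tor (Tor W U) V)"
    if "U \<in> VF" "V \<in> VF" "W \<in> VF" for U V W
    unfolding b_def by (rule bianchi1[OF that])
  \<comment> \<open>On the torsion side every term has a mixed pair of arguments, which gives zero,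
    or takes values of type (0,1), which the projection kills.\<close>
  have "B = 0"
    using X Y Z unfolding B_def
    by (simp only: b j_VF linear_simps NTor_VF Tor_VF VF_add VF_diff)
      (simp only: NTor_j Tor_j_left Tor_j_right Tor_uminus NTor_VF Tor_VF j_VF j_j VF_uminus j_uminus,
       simp add: algebra_simps)
  with BP have "P + P = 0" by simp
  then have "P p f + P p f = 0" for p f
    by (metis plus_fun_apply zero_fun_apply)
  then have "P = 0" by (intro ext) simp
  then show ?thesis by (simp add: P_def eq_neg_iff_add_eq_0)
qed

text \<open>Apply the commutator of derivatives along \<open>X\<close> and \<open>Y\<close> to
  \<open>met g Z W\<close>: the mixed products of first derivatives are symmetric in
  \<open>X\<close> and \<open>Y\<close> and drop out.\<close>

lemma Rm_skew:
  assumes X: "X \<in> VF" and Y: "Y \<in> VF" and Z: "Z \<in> VF" and W: "W \<in> VF"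
  shows "met g (Rm X Y Z) W p = - met g Z (Rm X Y W) p"
proof -
  have dd: "U p (\<lambda>q. V q (met g Z W)) = met g (D U (D V Z)) W p + met g (D V Z) (D U W) p
      + (met g (D U Z) (D V W) p + met g Z (D U (D V W)) p)"
    if U: "U \<in> VF" and V: "V \<in> VF" for U V
  proof -
    have "(\<lambda>q. V q (met g Z W)) = (\<lambda>q. met g (D V Z) W q + met g Z (D V W) q)"
      using V Z W by (simp add: D_met)
    then have "U p (\<lambda>q. V q (met g Z W)) = U p (\<lambda>q. met g (D V Z) W q + met g Z (D V W) q)"
      by simp
    also have "\<dots> = U p (met g (D V Z) W) + U p (met g Z (D V W))"
      using U V Z W by (intro VF_der_add) simp_all
    finally show ?thesis
      using U V Z W by (simp add: D_met)
  qed
  have "br X Y p (met g Z W) = X p (\<lambda>q. Y q (met g Z W)) - Y p (\<lambda>q. X q (met g Z W))"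
    by (simp only: lie_bracket_apply)
  then have "met g (D (br X Y) Z) W p + met g Z (D (br X Y) W) p =
      X p (\<lambda>q. Y q (met g Z W)) - Y p (\<lambda>q. X q (met g Z W))"
    using X Y Z W by (simp add: D_met)
  then show ?thesis
    using X Y Z W by (simp add: dd Rm_def met_diff_left met_diff_right)
qed

text \<open>The difference \<open>P\<close> equals \<open>- j Q\<close>, where \<open>Q\<close> is
  skew and commutes with the skew map \<open>j\<close>; such a product is symmetric. But
  \<open>P\<close> is also skew, so it vanishes.\<close>

lemma Rm_j_j:
  assumes X: "X \<in> VF" and Y: "Y \<in> VF" and Z: "Z \<in> VF"
  shows "Rm (j X) (j Y) Z = Rm X Y Z"
proof -
  define P where "P Z = Rm X Y Z - Rm (j X) (j Y) Z" for Z
  define Q where "Q Z = Rm (j X) Y Z + Rm X (j Y) Z" for Z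
  have PV: "P Z \<in> VF" and QV: "Q Z \<in> VF" if "Z \<in> VF" for Z
    using X Y that by (simp_all add: P_def Q_def)
  have PQ: "P Z = - j (Q Z)" if "Z \<in> VF" for Z
    using Rm_j_j_aux[OF X Y that] by (simp add: P_def Q_def)
  have Pskew: "met g (P Z) W p = - met g Z (P W) p" if "Z \<in> VF" "W \<in> VF" for Z W p
    using X Y that by (simp add: P_def met_diff_left met_diff_right Rm_skew)
  have Qskew: "met g (Q Z) W p = - met g Z (Q W) p" if "Z \<in> VF" "W \<in> VF" for Z W p
    using X Y that by (simp add: Q_def met_add_left met_add_right Rm_skew)
  have Qj: "Q (j Z) = j (Q Z)" if "Z \<in> VF" for Z
    using X Y that by (simp add: Q_def Rm_j j_add)
  have "met g (P Z) W p = 0" if W: "W \<in> VF" for W p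
  proof -
    have "met g (P Z) W p = met g (Q Z) (j W) p"
      using Z W QV by (simp add: PQ met_uminus_left met_j_left)
    also have "\<dots> = - met g Z (j (Q W)) p"
      using Z W by (simp add: Qskew Qj)
    also have "\<dots> = met g Z (P W) p"
      using Z W QV by (simp add: PQ met_uminus_right)
    finally show ?thesis
      using Pskew[OF Z W] by simp
  qed
  then have "P Z p = 0" for p
    using PV[OF Z] by (intro met_nondegenerate) auto
  then have "P Z = 0"
    by (intro ext) simp
  then show ?thesis by (simp add: P_def)
qed

lemma NRm_swap: "X \<in> VF \<Longrightarrow> Y \<in> VF \<Longrightarrow> Z \<in> VF \<Longrightarrow> W \<in> VF \<Longrightarrow> NRm X Z Y W = - NRm X Y Z W"
  by (simp add: NRm_def Rm_swap[of Y Z] Rm_swap[of "D X Y" Z] Rm_swap[of Y "D X Z"] linear_simps)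

text \<open>Subtracting the second Bianchi identity for \<open>j X, j Y, E\<close> from the one for \<open>X, Y, E\<close> leaves
  only derivatives along \<open>X, Y, j X, j Y\<close> and a curvature term that detects the torsion.\<close>

lemma bianchi2_j:
  assumes X: "X \<in> VF" and Y: "Y \<in> VF" and E: "E \<in> VF"
  shows "NRm X Y E E - NRm Y X E E - NRm (j X) (j Y) E E + NRm (j Y) (j X) E E
    + (Rm (Tor X Y) E E + Rm (Tor X Y) E E) = 0"
proof -
  have 1: "NRm X Y E E + NRm Y E X E + NRm E X Y E +
    (Rm (Tor X Y) E E + Rm (Tor Y E) X E + Rm (Tor E X) Y E) = 0"
    using bianchi2[OF X Y E E] .
  have 2: "NRm (j X) (j Y) E E + NRm (j Y) E (j X) E + NRm E (j X) (j Y) E +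
    (Rm (Tor (j X) (j Y)) E E + Rm (Tor (j Y) E) (j X) E + Rm (Tor E (j X)) (j Y) E) = 0"
    using bianchi2[of "j X" "j Y" E E] X Y E by simp
  \<comment> \<open>Invariance of the curvature survives differentiation along \<open>E\<close>
    because \<open>j\<close> commutes with \<open>D E\<close>.\<close>
  have 3: "NRm E (j X) (j Y) E = NRm E X Y E"
    using X Y E by (simp add: NRm_def D_j Rm_j_j)
  \<comment> \<open>In the first equation both factors \<open>j\<close> come out of the torsion and
    give -1; in the other two one comes out and is absorbed by invariance of the curvature.\<close>
  have 4: "Rm (Tor (j X) (j Y)) E E = - Rm (Tor X Y) E E"
    "Rm (Tor (j Y) E) (j X) E = Rm (Tor Y E) X E" "Rm (Tor E (j X)) (j Y) E = Rm (Tor E X) Y E"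
    using X Y E by (simp_all add: Tor_j_left Tor_j_right Rm_uminus Rm_j_j)
  have 5: "NRm Y E X E = - NRm Y X E E" "NRm (j Y) E (j X) E = - NRm (j Y) (j X) E E"
    using X Y E by (simp_all add: NRm_swap[of _ _ E])
  have "(NRm X Y E E + - NRm Y X E E + NRm E X Y E +
    (Rm (Tor X Y) E E + Rm (Tor Y E) X E + Rm (Tor E X) Y E)) -
    (NRm (j X) (j Y) E E + - NRm (j Y) (j X) E E + NRm E X Y E +
    (- Rm (Tor X Y) E E + Rm (Tor Y E) X E + Rm (Tor E X) Y E)) = 0 - 0"
    using 1 2 unfolding 3 4 5 by (rule arg_cong2[where f = minus])
  then show ?thesis by (simp add: algebra_simps)
qed

lemma Rm_add:
  "X \<in> VF \<Longrightarrow> X' \<in> VF \<Longrightarrow> Y \<in> VF \<Longrightarrow> Z \<in> VF \<Longrightarrow> Rm Y (X + X') Z = Rm Y X Z + Rm Y X' Z"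
  "X \<in> VF \<Longrightarrow> X' \<in> VF \<Longrightarrow> Y \<in> VF \<Longrightarrow> Z \<in> VF \<Longrightarrow> Rm Y Z (X + X') = Rm Y Z X + Rm Y Z X'"
  by (simp_all add: Rm_def linear_simps)

text \<open>These are the two slots over which the Ricci trace runs. First derivatives of
  \<open>f\<close> cancel, for the slot \<open>E\<close> against the bracket term; for the slot
  \<open>F\<close> the second derivatives form a commutator minus a bracket.\<close>

lemma Rm_tensorial:
  assumes Y: "Y \<in> VF" and W: "W \<in> VF"
  shows "F \<in> VF \<Longrightarrow> tensorial (\<lambda>E. met g (Rm Y E F) W)"
    and "E \<in> VF \<Longrightarrow> tensorial (\<lambda>F. met g (Rm Y E F) W)"
proof -
  assume F: "F \<in> VF"
  have "Rm Y (fscale f E) F = fscale f (Rm Y E F)" if f: "f \<in> SF" and E: "E \<in> VF" for f E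
  proof (intro ext)
    fix p h
    show "Rm Y (fscale f E) F p h = fscale f (Rm Y E F) p h"
      using Y E F f by (simp add: Rm_def D_fscale_left D_fscale_right lie_bracket_fscale_right
          D_add_left algebra_simps)
  qed
  then show "tensorial (\<lambda>E. met g (Rm Y E F) W)"
    using Y F W unfolding tensorial_def
    by (auto simp: met_fscale_left met_add_left Rm_add)
next
  assume E: "E \<in> VF"
  have "Rm Y E (fscale f F) = fscale f (Rm Y E F)" if f: "f \<in> SF" and F: "F \<in> VF" for f F
  proof (intro ext)
    fix p h
    show "Rm Y E (fscale f F) p h = fscale f (Rm Y E F) p h"
      using Y E F f by (simp add: Rm_def D_fscale_right D_add_right lie_bracket_apply algebra_simps)
  qed
  then show "tensorial (\<lambda>F. met g (Rm Y E F) W)"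
    using Y E W unfolding tensorial_def
    by (auto simp: met_fscale_left met_add_left Rm_add)
qed

end

subsection \<open>The real Chern-Einstein condition\<close>

locale chern_einstein_manifold = chern_manifold A g J D
  for A :: "('m::{t2_space, second_countable_topology}, 'e::euclidean_space) atlas"
    and g :: "'m metric" and J :: "'m endo" and D :: "'m connection" +
  fixes c :: real
  assumes einstein: "einstein A g D c"
begin

text \<open>Frees the Einstein condition from the particular frame picked by \<open>SOME\<close> in
  \<open>ricci\<close>.\<close>

lemma trace_Rm:
  assumes E: "orthonormal_frame_at A g p E" and X: "X \<in> VF" and W: "W \<in> VF"
  shows "(\<Sum>i<DIM('e). met g (Rm X (E i) (E i)) W p) = c * met g X W p"
proof -
  define E' where "E' = (SOME E. orthonormal_frame_at A g p E)"
  have E': "orthonormal_frame_at A g p E'"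
    unfolding E'_def using exists_orthonormal_frame_at by (rule someI_ex)
  have "c * met g X W p = ricci A g D X W p"
    using einstein X W by (simp add: einstein_def)
  also have "\<dots> = (\<Sum>i<DIM('e). met g (Rm X (E' i) (E' i)) W p)"
    by (simp add: ricci_def curvature_eq_Rm Let_def E'_def)
  also have "\<dots> = (\<Sum>i<DIM('e). met g (Rm X (E i) (E i)) W p / met g (E i) (E i) p)"
    by (rule trace_orthogonal[OF Rm_tensorial[OF X W] E'])
       (use E in \<open>auto simp: orthonormal_frame_at_def\<close>)
  also have "\<dots> = (\<Sum>i<DIM('e). met g (Rm X (E i) (E i)) W p)"
    using E by (intro sum.cong) (auto simp: orthonormal_frame_at_def)
  finally show ?thesis by simp
qed

text \<open>The trace of the covariant derivative of the curvature is that of the Ricci tensor,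
  which is \<open>c\<close> times that of \<open>g\<close>. The work lies in the frame, which is
  neither parallel nor unit near \<open>p\<close>.\<close>

lemma trace_NRm:
  assumes F: "\<And>i. i < DIM('e) \<Longrightarrow> F i \<in> VF"
    and orth: "\<And>i k. i < DIM('e) \<Longrightarrow> k < DIM('e) \<Longrightarrow> i \<noteq> k \<Longrightarrow> met g (F i) (F k) = (\<lambda>_. 0)"
    and unit: "\<And>i. i < DIM('e) \<Longrightarrow> met g (F i) (F i) p = 1"
    and X: "X \<in> VF" and Y: "Y \<in> VF" and W: "W \<in> VF"
  shows "(\<Sum>i<DIM('e). met g (NRm X Y (F i) (F i)) W p) = 0"
proof -
  define B where "B E E' = met g (Rm Y E E') W" for E E'
  note tens = Rm_tensorial[OF Y W, folded B_def]
  have FE: "orthonormal_frame_at A g p F"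
    using F orth unit by (auto simp: orthonormal_frame_at_def)
  define N where "N i = X p (met g (F i) (F i))" for i
  define s where "s i k = met g (D X (F i)) (F k) p" for i k
  \<comment> \<open>The connection matrix of the frame is skew up to a diagonal, which records how
    the squared lengths change at \<open>p\<close>.\<close>
  have s: "s i k + s k i = (if i = k then N i else 0)" if "i < DIM('e)" "k < DIM('e)" for i k
  proof -
    have "X p (met g (F i) (F k)) = s i k + s k i"
      using D_met[of X "F i" "F k" p] met_sym[of "F i" "D X (F k)"] X F that by (simp add: s_def)
    moreover have "X p (met g (F i) (F k)) = 0" if "i \<noteq> k"
      using orth[of i k] that \<open>i < DIM('e)\<close> \<open>k < DIM('e)\<close> VF_const[OF X] by simp
    ultimately show ?thesis by (auto simp: N_def)
  qed
  have "X p (\<lambda>q. c * met g Y W q) =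
      (\<Sum>i<DIM('e). X p (B (F i) (F i)) - X p (met g (F i) (F i)) * B (F i) (F i) p)"
  proof (rule trace_derivative[where B = B and p = p, OF tens _ _ _ F orth unit])
    show "B E E' \<in> SF" if "E \<in> VF" "E' \<in> VF" for E E'
      using that Y W by (simp add: B_def met_SF)
    show "(\<lambda>q. c * met g Y W q) \<in> SF"
      using Y W by (intro SF_mult SF_const met_SF)
    show "c * met g Y W q = (\<Sum>i<DIM('e). B (E i) (E i) q)" if "orthonormal_frame_at A g q E" for q E
      using trace_Rm[OF that Y W] by (simp add: B_def)
    show "X p \<in> T p" using X by (rule VF_tangent)
  qed
  moreover have "X p (\<lambda>q. c * met g Y W q) = c * (met g (D X Y) W p + met g Y (D X W) p)"
    using VF_der_scale[OF X, of "met g Y W" p c] X Y W by (simp add: D_met)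
  ultimately have tr: "(\<Sum>i<DIM('e). X p (B (F i) (F i))) =
      c * (met g (D X Y) W p + met g Y (D X W) p) + (\<Sum>i<DIM('e). N i * B (F i) (F i) p)"
    by (simp add: sum_subtractf N_def)
  \<comment> \<open>After renaming indices only the symmetric part of \<open>s\<close> enters, so
    this is exactly the length correction coming from \<open>trace_derivative\<close>, and the two
    cancel.\<close>
  have "(\<Sum>i<DIM('e). B (D X (F i)) (F i) p + B (F i) (D X (F i)) p) =
      (\<Sum>i<DIM('e). N i * B (F i) (F i) p)"
  proof -
    have exp: "D X (F i) p = (\<Sum>k<DIM('e). tscale (s i k) (F k p))" if "i < DIM('e)" for i
    proof -
      have "D X (F i) p = (\<Sum>k<DIM('e). tscale (g p (D X (F i) p) (F k p) / met g (F k) (F k) p) (F k p))"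
        by (rule orthogonal_expansion) (use X F orth unit that in auto)
      also have "\<dots> = (\<Sum>k<DIM('e). tscale (s i k) (F k p))"
        using unit by (intro sum.cong) (auto simp: s_def met_def)
      finally show ?thesis .
    qed
    have "B (D X (F i)) (F i) p = (\<Sum>k<DIM('e). s i k * B (F k) (F i) p)" if "i < DIM('e)" for i
      using tensorial_expand[OF tens(1), of "F i" "D X (F i)" "{..<DIM('e)}" F p "s i"] X F that exp
      by simp
    moreover have "B (F i) (D X (F i)) p = (\<Sum>k<DIM('e). s i k * B (F i) (F k) p)" if "i < DIM('e)" for i
      using tensorial_expand[OF tens(2), of "F i" "D X (F i)" "{..<DIM('e)}" F p "s i"] X F that exp
      by simp
    ultimately have "(\<Sum>i<DIM('e). B (D X (F i)) (F i) p + B (F i) (D X (F i)) p) =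
        (\<Sum>i<DIM('e). \<Sum>k<DIM('e). s i k * B (F k) (F i) p) +
        (\<Sum>i<DIM('e). \<Sum>k<DIM('e). s i k * B (F i) (F k) p)"
      by (simp add: sum.distrib)
    also have "(\<Sum>i<DIM('e). \<Sum>k<DIM('e). s i k * B (F i) (F k) p) =
        (\<Sum>i<DIM('e). \<Sum>k<DIM('e). s k i * B (F k) (F i) p)"
      by (rule sum.swap)
    also have "(\<Sum>i<DIM('e). \<Sum>k<DIM('e). s i k * B (F k) (F i) p) + \<dots> =
        (\<Sum>i<DIM('e). \<Sum>k<DIM('e). (s i k + s k i) * B (F k) (F i) p)"
      by (simp add: sum.distrib distrib_right)
    also have "\<dots> = (\<Sum>i<DIM('e). \<Sum>k<DIM('e). if k = i then N i * B (F i) (F i) p else 0)"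
      by (intro sum.cong refl) (simp add: s)
    finally show ?thesis by simp
  qed
  moreover have "(\<Sum>i<DIM('e). met g (NRm X Y (F i) (F i)) W p) =
      (\<Sum>i<DIM('e). X p (B (F i) (F i)) - met g (Rm Y (F i) (F i)) (D X W) p
        - met g (Rm (D X Y) (F i) (F i)) W p - (B (D X (F i)) (F i) p + B (F i) (D X (F i)) p))"
  proof (intro sum.cong refl)
    fix i assume "i \<in> {..<DIM('e)}"
    then show "met g (NRm X Y (F i) (F i)) W p = X p (B (F i) (F i)) - met g (Rm Y (F i) (F i)) (D X W) p
        - met g (Rm (D X Y) (F i) (F i)) W p - (B (D X (F i)) (F i) p + B (F i) (D X (F i)) p)"
      using X Y W F[of i] by (simp add: NRm_def B_def met_diff_left D_met)
  qed
  ultimately show ?thesis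
    using tr trace_Rm[OF FE, of Y "D X W"] trace_Rm[OF FE, of "D X Y" W] X Y W
    by (simp only: sum_subtractf D_VF) (simp add: algebra_simps)
qed

lemma torsion_zero:
  assumes c: "c \<noteq> 0" and X: "X \<in> VF" and Y: "Y \<in> VF"
  shows "Tor X Y = 0"
proof
  fix p
  obtain F where F: "\<And>i. i < DIM('e) \<Longrightarrow> F i \<in> VF"
    and orth: "\<And>i k. i < DIM('e) \<Longrightarrow> k < DIM('e) \<Longrightarrow> i \<noteq> k \<Longrightarrow> met g (F i) (F k) = (\<lambda>_. 0)"
    and unit: "\<And>i. i < DIM('e) \<Longrightarrow> met g (F i) (F i) p = 1"
    using exists_orthogonal_fields[of "DIM('e)" p] by auto
  have FE: "orthonormal_frame_at A g p F"
    using F orth unit by (auto simp: orthonormal_frame_at_def)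
  have "met g (Tor X Y) W p = 0" if W: "W \<in> VF" for W
  proof -
    define t where "t X Y i = met g (NRm X Y (F i) (F i)) W p" for X Y i
    have "t X Y i - t Y X i - t (j X) (j Y) i + t (j Y) (j X) i
        + 2 * met g (Rm (Tor X Y) (F i) (F i)) W p = 0" if "i < DIM('e)" for i
    proof -
      have "met g (NRm X Y (F i) (F i) - NRm Y X (F i) (F i) - NRm (j X) (j Y) (F i) (F i)
          + NRm (j Y) (j X) (F i) (F i)
          + (Rm (Tor X Y) (F i) (F i) + Rm (Tor X Y) (F i) (F i))) W p = 0"
        unfolding bianchi2_j[OF X Y F[OF that]] using W by (simp add: met_def)
      then show ?thesis
        using X Y W F[OF that]
        by (simp only: met_add_left met_diff_left VF_add VF_diff NRm_VF Rm_VF Tor_VF j_VF)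
          (simp add: t_def)
    qed
    then have "(\<Sum>i<DIM('e). t X Y i - t Y X i - t (j X) (j Y) i + t (j Y) (j X) i
        + 2 * met g (Rm (Tor X Y) (F i) (F i)) W p) = 0"
      by simp
    moreover have "(\<Sum>i<DIM('e). t X Y i) = 0" if "X \<in> VF" "Y \<in> VF" for X Y
      unfolding t_def using F orth unit that W by (intro trace_NRm) auto
    ultimately have "2 * (\<Sum>i<DIM('e). met g (Rm (Tor X Y) (F i) (F i)) W p) = 0"
      using X Y by (simp add: sum.distrib sum_subtractf sum_distrib_left)
    \<comment> \<open>The torsion sits in the first slot of \<open>Rm\<close>, so the trace is the
      Ricci curvature of \<open>Tor X Y\<close> and \<open>W\<close>.\<close>
    then show ?thesis
      using trace_Rm[OF FE, of "Tor X Y" W] c X Y W by simp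
  qed
  then show "Tor X Y p = 0 p"
    using X Y met_nondegenerate[of "Tor X Y" p] by simp
qed

end

text \<open>For a torsion-free connection the exterior derivative is the alternation of the
  covariant derivative, and the fundamental form is parallel because \<open>g\<close> and
  \<open>J\<close> are.\<close>

lemma (in chern_manifold) ext_deriv2_fundamental_form:
  assumes X: "X \<in> VF" and Y: "Y \<in> VF" and Z: "Z \<in> VF"
    and tor: "\<And>X Y. X \<in> VF \<Longrightarrow> Y \<in> VF \<Longrightarrow> Tor X Y = 0"
  shows "ext_deriv2 (fundamental_form g J) X Y Z = 0"
proof
  fix p
  have br: "br U V = D U V - D V U" if "U \<in> VF" "V \<in> VF" for U V
    using tor[OF that] by (simp add: Tor_def)
  have sk: "met g (j U) V p = - met g (j V) U p" if "U \<in> VF" "V \<in> VF" for U V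
    using that met_j_left[of U V p] met_sym[of U "j V"] by simp
  have dw: "U p (met g (j V) W) = met g (j (D U V)) W p - met g (j (D U W)) V p"
    if "U \<in> VF" "V \<in> VF" "W \<in> VF" for U V W
    using that sk[of V "D U W"] by (simp add: D_met D_j)
  have "met g (j (br U V)) W p = met g (j (D U V)) W p - met g (j (D V U)) W p"
    if "U \<in> VF" "V \<in> VF" "W \<in> VF" for U V W
    unfolding br[OF that(1,2)] using that by (simp add: j_diff met_diff_left)
  moreover have "ext_deriv2 (fundamental_form g J) X Y Z p =
      X p (met g (j Y) Z) - Y p (met g (j X) Z) + Z p (met g (j X) Y)
      - met g (j (br X Y)) Z p + met g (j (br X Z)) Y p - met g (j (br Y Z)) X p"
    unfolding ext_deriv2_def fundamental_form_def ..
  ultimately have "ext_deriv2 (fundamental_form g J) X Y Z p = 0"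
    using X Y Z dw[OF X Y Z] dw[OF Y X Z] dw[OF Z X Y] by simp
  then show "ext_deriv2 (fundamental_form g J) X Y Z p = 0 p"
    by (rule trans) (rule zero_fun_apply[symmetric])
qed

theorem theorem1p3:
  fixes A :: "('m::{t2_space, second_countable_topology}, 'e::euclidean_space) atlas"
    and g :: "'m metric"
    and J :: "'m endo"
    and D :: "'m connection"
    and c :: real
  assumes "compact (UNIV :: 'm set)"
    and "hermitian_manifold A g J"
    and "real_chern_connection A g J D"
    and "einstein A g D c"
    and "c \<noteq> 0"
  shows "kaehler_einstein A g J"
proof -
  interpret chern_einstein_manifold A g J D c
    using assms by unfold_locales (simp_all add: hermitian_manifold_def)
  note tor = torsion_zero[OF assms(5)]
  \<comment> \<open>A metric connection without torsion is the Levi-Civita connection, so the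
    Einstein condition for \<open>D\<close> already is the Riemannian one, with the same
    constant.\<close>
  have "levi_civita_connection A g D"
    using affine chern tor by (simp add: levi_civita_connection_def real_chern_connection_def Tor_def)
  then show ?thesis
    using einstein ext_deriv2_fundamental_form[OF _ _ _ tor]
    unfolding kaehler_einstein_def by blast
qed

end
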